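(* Let $R$ be a left Artinian ring. Then: 1. The map $\mathcal I_l'(R)\to\{\mathrm{ass}(S_e): e\in\mathcal I_l'(R)\}$, $e\mapsto \mathrm{ass}(S_e)=(1-e)R$, is a bijection. 2. The map $\mathcal I_l'(R)\to \mathcal I_l(R)/\!\sim$, $e\mapsto[e]$, is a bijection. 3. The map $\mathcal I_l'(R)\to\mathrm{Loc}_l(R)$, $e\mapsto S_e^{-1}R=R/(1-e)R$, is a bijection. So $\mathrm{Loc}_l(R)=\{S_e^{-1}R: e\in\mathcal I_l'(R)\}$, $|\mathrm{Loc}_l(R)|=|\mathcal I_l'(R)|<\infty$, and up to isomorphism there are only finitely many left localizations of the ring $R$. 4. Let $e,f\in\mathcal I_l'(R)$. Then $S_e^{-1}R=S_f^{-1}R$ in $\mathrm{Loc}_l(R)$ iff $\mathrm{ass}(S_e)=\mathrm{ass}(S_f)$ iff $e=f$. 5. Let $e,f\in\mathcal I_l'(R)$. Then $e\geq f$ iff $[e]\geq[f]$ iff the map $S_e^{-1}R\to S_f^{-1}R$, $e^ir\mapsto e^ir=\frac r1$ ($i=0,-1$, $r\in R$), is well-defined iff $\mathrm{ass}(S_e)\subseteq\mathrm{ass}(S_f)$. 6. The map $\mathcal I_l'(R)\to\mathrm{Ass}_l(R)$, $e\mapsto(1-e)R$, is a bijection; i.e. $\mathrm{Ass}_l(R)=\{(1-e)R: e\in\mathcal I_l'(R)\}$ is a finite set and $|\mathrm{Ass}_l(R)|=|\mathcal I_l'(R)|<\infty$.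
   Context: Rings are associative with $1\neq0$. A multiplicative set $S\subseteq R$ satisfies $1\in S$, $SS\subseteq S$, $0\notin S$. It is a left Ore set if $Sr\cap Rs\neq\emptyset$ for all $r\in R$, $s\in S$; put $\mathrm{ass}(S)=\{r\in R: sr=0\text{ for some }s\in S\}$. A left Ore set $S$ is a left denominator set if $rs=0$ with $r\in R$, $s\in S$ implies $tr=0$ for some $t\in S$. $\mathrm{Den}_l(R)$ is the set of left denominator sets, $\mathrm{Ass}_l(R)=\{\mathrm{ass}(S):S\in\mathrm{Den}_l(R)\}$, and $\mathrm{Loc}_l(R)$ is the set of $R$-isomorphism classes of left localizations $S^{-1}R$, $S\in\mathrm{Den}_l(R)$. Here $S^{-1}R$ and $S'^{-1}R$ are $R$-isomorphic, written $S^{-1}R=S'^{-1}R$ in $\mathrm{Loc}_l(R)$, if $s^{-1}r\mapsto s^{-1}r$ is a well-defined isomorphism $S^{-1}R\to S'^{-1}R$ (equivalently, there is a ring isomorphism commuting with the canonical maps from $R$). For a nonzero idempotent $e$, $S_e=\{1,e\}$. $\mathcal I_l(R)$ is the set of nonzero idempotents $e\in R$ with $S_e\in\mathrm{Den}_l(R)$ (equivalently $eR(1-e)=0$). It is pre-ordered by: $e\geq f$ iff $fe=f$. Write $e\sim f$ iff $e\geq f$ and $f\geq e$; $[e]$ is the $\sim$-class of $e$, and $\mathcal I_l(R)/\!\sim$ is partially ordered by $[e]\geq[f]$ iff $e\geq f$. For $R$ left Artinian, write $R/\mathrm{rad}(R)=\prod_{i=1}^s\overline R_i$, a product of simple Artinian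 rings ($\mathrm{rad}$ = Jacobson radical), with $\overline 1_i$ the identity of $\overline R_i$. Fix orthogonal idempotents $1_1,\dots,1_s$ of $R$ with $1=\sum_i1_i$ and $1_i+\mathrm{rad}(R)=\overline1_i$. For nonempty $I\subseteq\{1,\dots,s\}$ put $e_I=\sum_{i\in I}1_i$. Then $\mathcal I_l'(R)=\{e_I: \emptyset\neq I\subseteq\{1,\dots,s\},\ e_IR(1-e_I)=0\}$. *)

theory Defs
  imports "HOL-Algebra.Algebra"
begin

section \<open>Left Artinian rings and the Jacobson radical\<close>

definition left_ideal :: "'a set \<Rightarrow> ('a, 'm) ring_scheme \<Rightarrow> bool" where
  "left_ideal I R \<longleftrightarrow> additive_subgroup I R \<and>
     (\<forall>a\<in>carrier R. \<forall>x\<in>I. a \<otimes>\<^bsub>R\<^esub> x \<in> I)"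

definition left_artinian :: "('a, 'm) ring_scheme \<Rightarrow> bool" where
  "left_artinian R \<longleftrightarrow>
     (\<forall>I :: nat \<Rightarrow> 'a set. (\<forall>n. left_ideal (I n) R \<and> I (Suc n) \<subseteq> I n) \<longrightarrow>
        (\<exists>N. \<forall>n\<ge>N. I n = I N))"

definition maximal_left_ideal :: "'a set \<Rightarrow> ('a, 'm) ring_scheme \<Rightarrow> bool" where
  "maximal_left_ideal M R \<longleftrightarrow> left_ideal M R \<and> M \<noteq> carrier R \<and>
     (\<forall>J. left_ideal J R \<and> M \<subseteq> J \<longrightarrow> J = M \<or> J = carrier R)"

definition jacobson_rad :: "('a, 'm) ring_scheme \<Rightarrow> 'a set" where
  "jacobson_rad R = {r \<in> carrier R. \<forall>M. maximal_left_ideal M R \<longrightarrow> r \<in> M}"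

text \<open>For simple rings, left Artinian and right Artinian are the same condition.\<close>

definition simple_artinian :: "('a, 'm) ring_scheme \<Rightarrow> bool" where
  "simple_artinian B \<longleftrightarrow> ring B \<and> \<one>\<^bsub>B\<^esub> \<noteq> \<zero>\<^bsub>B\<^esub> \<and>
     (\<forall>I. ideal I B \<longrightarrow> I = {\<zero>\<^bsub>B\<^esub>} \<or> I = carrier B) \<and> left_artinian B"

text \<open>The identity of the \<open>i\<close>-th factor, as an element of the product ring \<open>RDirProd_list Bs\<close>,
  whose elements are lists of length \<open>length Bs\<close>.\<close>

definition factor_one :: "('b, 'n) ring_scheme list \<Rightarrow> nat \<Rightarrow> 'b list" where
  "factor_one Bs i =
     map (\<lambda>j. if j = i then \<one>\<^bsub>Bs ! j\<^esub> else \<zero>\<^bsub>Bs ! j\<^esub>) [0..<length Bs]"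


section \<open>Left denominator sets\<close>

definition multiplicative_set :: "('a, 'm) ring_scheme \<Rightarrow> 'a set \<Rightarrow> bool" where
  "multiplicative_set R S \<longleftrightarrow> S \<subseteq> carrier R \<and> \<one>\<^bsub>R\<^esub> \<in> S \<and>
     (\<forall>s\<in>S. \<forall>t\<in>S. s \<otimes>\<^bsub>R\<^esub> t \<in> S) \<and> \<zero>\<^bsub>R\<^esub> \<notin> S"

definition left_Ore_set :: "('a, 'm) ring_scheme \<Rightarrow> 'a set \<Rightarrow> bool" where
  "left_Ore_set R S \<longleftrightarrow> multiplicative_set R S \<and>
     (\<forall>r\<in>carrier R. \<forall>s\<in>S.
        {t \<otimes>\<^bsub>R\<^esub> r | t. t \<in> S} \<inter> {q \<otimes>\<^bsub>R\<^esub> s | q. q \<in> carrier R} \<noteq> {})"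

definition ass :: "('a, 'm) ring_scheme \<Rightarrow> 'a set \<Rightarrow> 'a set" where
  "ass R S = {r \<in> carrier R. \<exists>s\<in>S. s \<otimes>\<^bsub>R\<^esub> r = \<zero>\<^bsub>R\<^esub>}"

definition left_denominator_set :: "('a, 'm) ring_scheme \<Rightarrow> 'a set \<Rightarrow> bool" where
  "left_denominator_set R S \<longleftrightarrow> left_Ore_set R S \<and>
     (\<forall>r\<in>carrier R. \<forall>s\<in>S. r \<otimes>\<^bsub>R\<^esub> s = \<zero>\<^bsub>R\<^esub> \<longrightarrow> (\<exists>t\<in>S. t \<otimes>\<^bsub>R\<^esub> r = \<zero>\<^bsub>R\<^esub>))"

definition Den_l :: "('a, 'm) ring_scheme \<Rightarrow> 'a set set" where
  "Den_l R = {S. left_denominator_set R S}"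

definition Ass_l :: "('a, 'm) ring_scheme \<Rightarrow> 'a set set" where
  "Ass_l R = {ass R S | S. S \<in> Den_l R}"


section \<open>Left localizations\<close>

text \<open>\<open>lfrac R S s r\<close> is the left fraction \<open>s\<inverse>r\<close>: the class of the pair \<open>(s, r)\<close> under the Ore
  equivalence, in which \<open>(s, r)\<close> and \<open>(t, q)\<close> are identified when they become equal after
  passing to a common denominator \<open>c s = d t \<in> S\<close>.\<close>

definition lfrac :: "('a, 'm) ring_scheme \<Rightarrow> 'a set \<Rightarrow> 'a \<Rightarrow> 'a \<Rightarrow> ('a \<times> 'a) set" where
  "lfrac R S s r = {(t, q). t \<in> S \<and> q \<in> carrier R \<and>
     (\<exists>c\<in>carrier R. \<exists>d\<in>carrier R.
        c \<otimes>\<^bsub>R\<^esub> s = d \<otimes>\<^bsub>R\<^esub> t \<and> c \<otimes>\<^bsub>R\<^esub> s \<in> S \<and> c \<otimes>\<^bsub>R\<^esub> r = d \<otimes>\<^bsub>R\<^esub> q)}"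

text \<open>The ring of left fractions. Sum and product are given by
  \<open>s\<inverse>r + t\<inverse>q = (c s)\<inverse>(c r + d q)\<close> whenever \<open>c s = d t \<in> S\<close>, and
  \<open>s\<inverse>r \<cdot> t\<inverse>q = (c s)\<inverse>(d q)\<close> whenever \<open>c r = d t\<close> with \<open>c \<in> S\<close>.
  As for cosets in \<^term>\<open>set_add\<close> and \<^term>\<open>rcoset_mult\<close>, instead of choosing representatives
  and \<open>c\<close>, \<open>d\<close>, the union is taken over all of them; for a left denominator set all
  members of the union are the same class.\<close>

definition localization :: "('a, 'm) ring_scheme \<Rightarrow> 'a set \<Rightarrow> ('a \<times> 'a) set ring" where
  "localization R S =
     \<lparr>carrier = {lfrac R S s r | s r. s \<in> S \<and> r \<in> carrier R},
      monoid.mult = (\<lambda>V W. \<Union>{lfrac R S (c \<otimes>\<^bsub>R\<^esub> s) (d \<otimes>\<^bsub>R\<^esub> q) | s r t q c d.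
                (s, r) \<in> V \<and> (t, q) \<in> W \<and> c \<in> S \<and> d \<in> carrier R \<and>
                c \<otimes>\<^bsub>R\<^esub> r = d \<otimes>\<^bsub>R\<^esub> t}),
      one = lfrac R S \<one>\<^bsub>R\<^esub> \<one>\<^bsub>R\<^esub>,
      ring.zero = lfrac R S \<one>\<^bsub>R\<^esub> \<zero>\<^bsub>R\<^esub>,
      ring.add = (\<lambda>V W. \<Union>{lfrac R S (c \<otimes>\<^bsub>R\<^esub> s) (c \<otimes>\<^bsub>R\<^esub> r \<oplus>\<^bsub>R\<^esub> d \<otimes>\<^bsub>R\<^esub> q) | s r t q c d.
                (s, r) \<in> V \<and> (t, q) \<in> W \<and> c \<in> carrier R \<and> d \<in> carrier R \<and>
                c \<otimes>\<^bsub>R\<^esub> s = d \<otimes>\<^bsub>R\<^esub> t \<and> c \<otimes>\<^bsub>R\<^esub> s \<in> S})\<rparr>"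

definition loc_can :: "('a, 'm) ring_scheme \<Rightarrow> 'a set \<Rightarrow> 'a \<Rightarrow> ('a \<times> 'a) set" where
  "loc_can R S r = lfrac R S \<one>\<^bsub>R\<^esub> r"

text \<open>\<open>fraction_map R S S' h\<close> says that \<open>s\<inverse>r \<mapsto> s\<inverse>r\<close> is a well-defined map from
  \<open>S\<inverse>R\<close> to \<open>S'\<inverse>R\<close>, namely \<open>h\<close>. Since \<open>s \<in> S\<close> need not lie in \<open>S'\<close>, the
  expression \<open>s\<inverse>r\<close> in \<open>S'\<inverse>R\<close> is the product of the inverse of the image of \<open>s\<close>,
  which is required to be a unit, with the image of \<open>r\<close>.\<close>

definition fraction_map ::
  "('a, 'm) ring_scheme \<Rightarrow> 'a set \<Rightarrow> 'a set \<Rightarrow> (('a \<times> 'a) set \<Rightarrow> ('a \<times> 'a) set) \<Rightarrow> bool" where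
  "fraction_map R S S' h \<longleftrightarrow>
     h \<in> carrier (localization R S) \<rightarrow> carrier (localization R S') \<and>
     (\<forall>s\<in>S. loc_can R S' s \<in> Units (localization R S')) \<and>
     (\<forall>s\<in>S. \<forall>r\<in>carrier R.
        h (lfrac R S s r) =
          inv\<^bsub>localization R S'\<^esub> (loc_can R S' s) \<otimes>\<^bsub>localization R S'\<^esub> loc_can R S' r)"

definition R_isomorphic :: "('a, 'm) ring_scheme \<Rightarrow> 'a set \<Rightarrow> 'a set \<Rightarrow> bool" where
  "R_isomorphic R S S' \<longleftrightarrow>
     (\<exists>h \<in> ring_iso (localization R S) (localization R S'). fraction_map R S S' h)"

definition loc_class :: "('a, 'm) ring_scheme \<Rightarrow> 'a set \<Rightarrow> ('a \<times> 'a) set ring set" where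
  "loc_class R S = {localization R S' | S'. S' \<in> Den_l R \<and> R_isomorphic R S S'}"

definition Loc_l :: "('a, 'm) ring_scheme \<Rightarrow> ('a \<times> 'a) set ring set set" where
  "Loc_l R = {loc_class R S | S. S \<in> Den_l R}"


section \<open>Idempotents\<close>

definition S_idem :: "('a, 'm) ring_scheme \<Rightarrow> 'a \<Rightarrow> 'a set" where
  "S_idem R e = {\<one>\<^bsub>R\<^esub>, e}"

definition I_l :: "('a, 'm) ring_scheme \<Rightarrow> 'a set" where
  "I_l R = {e \<in> carrier R. e \<otimes>\<^bsub>R\<^esub> e = e \<and> e \<noteq> \<zero>\<^bsub>R\<^esub> \<and> S_idem R e \<in> Den_l R}"

definition idem_ge :: "('a, 'm) ring_scheme \<Rightarrow> 'a \<Rightarrow> 'a \<Rightarrow> bool" where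
  "idem_ge R e f \<longleftrightarrow> f \<otimes>\<^bsub>R\<^esub> e = f"

definition idem_sim :: "('a, 'm) ring_scheme \<Rightarrow> ('a \<times> 'a) set" where
  "idem_sim R = {(e, f). e \<in> I_l R \<and> f \<in> I_l R \<and> idem_ge R e f \<and> idem_ge R f e}"

definition idem_class :: "('a, 'm) ring_scheme \<Rightarrow> 'a \<Rightarrow> 'a set" where
  "idem_class R e = idem_sim R `` {e}"

definition class_ge :: "('a, 'm) ring_scheme \<Rightarrow> 'a set \<Rightarrow> 'a set \<Rightarrow> bool" where
  "class_ge R V W \<longleftrightarrow> (\<exists>e\<in>V. \<exists>f\<in>W. idem_ge R e f)"

text \<open>\<open>compl_ideal R e\<close> is \<open>(1 - e)R\<close>.\<close>

definition compl_ideal :: "('a, 'm) ring_scheme \<Rightarrow> 'a \<Rightarrow> 'a set" where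
  "compl_ideal R e = (\<one>\<^bsub>R\<^esub> \<ominus>\<^bsub>R\<^esub> e) <#\<^bsub>R\<^esub> carrier R"

definition e_sum :: "('a, 'm) ring_scheme \<Rightarrow> (nat \<Rightarrow> 'a) \<Rightarrow> nat set \<Rightarrow> 'a" where
  "e_sum R u I = (\<Oplus>\<^bsub>R\<^esub>i\<in>I. u i)"

definition I_l' :: "('a, 'm) ring_scheme \<Rightarrow> nat \<Rightarrow> (nat \<Rightarrow> 'a) \<Rightarrow> 'a set" where
  "I_l' R s u = {e_sum R u I | I. I \<noteq> {} \<and> I \<subseteq> {..<s} \<and>
     (\<forall>r\<in>carrier R.
        e_sum R u I \<otimes>\<^bsub>R\<^esub> r \<otimes>\<^bsub>R\<^esub> (\<one>\<^bsub>R\<^esub> \<ominus>\<^bsub>R\<^esub> e_sum R u I) = \<zero>\<^bsub>R\<^esub>)}"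

end

theory Submission
  imports Defs
begin

text \<open>
  For an idempotent \<open>e \<noteq> 0\<close> with \<open>eR(1 - e) = 0\<close> the set \<open>S_e = {1, e}\<close> is a left denominator set and
  \<open>ass S_e = (1 - e)R\<close>. The theorem says that in a left Artinian ring these sets account for all
  left localizations, and that \<open>e\<close> may be taken among the finitely many sums \<open>e_I\<close> of the fixed
  idempotents. Three facts carry it.

  \<^bold>\<open>A localization is determined by its kernel.\<close> Let \<open>S\<close> be a left denominator set of a left Artinian
  ring. By the descending chain condition some \<open>s \<in> S\<close> has \<open>Rs\<close> minimal among the left ideals
  generated by elements of \<open>S\<close>, so every \<open>t \<in> S\<close> satisfies \<open>yts = s\<close> for some \<open>y\<close> (\<open>artinian_absorbing_denominator\<close>). Reversibility turns
  this into invertibility of \<open>t\<close> modulo \<open>ass S\<close>, so \<open>S\<inverse>R\<close> is simply \<open>R/ass S\<close>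
  (\<open>artinian_inverting_quotient\<close>, \<open>frac_iso\<close>). Hence \<open>s\<inverse>r \<mapsto> s\<inverse>r\<close> is a well-defined map
  \<open>S\<inverse>R \<rightarrow> T\<inverse>R\<close> iff \<open>ass S \<subseteq> ass T\<close>, and an isomorphism iff \<open>ass S = ass T\<close>
  (\<open>fraction_map_iff\<close>, \<open>R_isomorphic_iff\<close>).

  \<^bold>\<open>Every kernel comes from an idempotent.\<close> By the Ore condition the same \<open>s\<close> annihilates
  \<open>ass S\<close> from the left. Taking \<open>t = s\<close> gives \<open>ys\<^sup>2 = s\<close>, so \<open>1 - ys \<in> ass S\<close> by reversibility and
  therefore \<open>sys = s\<close>. Hence \<open>e = ys\<close> is idempotent with the same right annihilator as \<open>s\<close>, namely
  \<open>ass S\<close>; that is, \<open>ass S = (1 - e)R\<close> (\<open>artinian_ass_eq_compl_ideal\<close>).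

  \<^bold>\<open>Every such idempotent is equivalent to exactly one \<open>e_I\<close>.\<close> If \<open>eR(1 - e) = 0\<close>, the image of
  \<open>e\<close> in each simple factor of \<open>R/rad R\<close> is \<open>0\<close> or \<open>1\<close>, so \<open>e\<close> agrees with some \<open>f = e_I\<close> modulo
  the radical. The elements \<open>e(1 - f)\<close> and \<open>f(1 - e)\<close> then lie in the radical, and the vanishing
  corner makes them idempotent; as the radical contains no nonzero idempotent, both are \<open>0\<close>, which
  says \<open>(1 - e)R = (1 - f)R\<close> (\<open>I_l_equivalent_I_l'\<close>). Uniqueness holds because the \<open>e_I\<close> commute:
  \<open>(1 - e)R = (1 - f)R\<close> means \<open>ef = e\<close> and \<open>fe = f\<close> (\<open>compl_ideal_inj_on_I_l'\<close>).

  Consequently all six assertions are statements about the right ideals \<open>(1 - e)R\<close> with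
  \<open>e \<in> I_l'\<close> and the inclusions between them.
\<close>

section \<open>Left denominator sets\<close>

locale denominator_set = R?: ring R for R (structure) +
  fixes S
  assumes denominators: "left_denominator_set R S"
begin

lemma denominator_carrier: "s \<in> S \<Longrightarrow> s \<in> carrier R"
  and denominator_one: "\<one> \<in> S"
  and denominator_mult: "\<lbrakk>s \<in> S; t \<in> S\<rbrakk> \<Longrightarrow> s \<otimes> t \<in> S"
  and denominator_nonzero: "\<zero> \<notin> S"
  using denominators
  unfolding left_denominator_set_def left_Ore_set_def multiplicative_set_def by blast+

lemma ore:
  assumes "r \<in> carrier R" "s \<in> S"
  obtains c d where "c \<in> S" "d \<in> carrier R" "c \<otimes> r = d \<otimes> s"
proof -
  have "{t \<otimes> r | t. t \<in> S} \<inter> {q \<otimes> s | q. q \<in> carrier R} \<noteq> {}"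
    using denominators assms unfolding left_denominator_set_def left_Ore_set_def by blast
  then show thesis using that by auto
qed

lemma reversible: "\<lbrakk>r \<in> carrier R; s \<in> S; r \<otimes> s = \<zero>\<rbrakk> \<Longrightarrow> r \<in> ass R S"
  using denominators unfolding left_denominator_set_def ass_def by blast

lemma assI: "\<lbrakk>r \<in> carrier R; s \<in> S; s \<otimes> r = \<zero>\<rbrakk> \<Longrightarrow> r \<in> ass R S"
  by (auto simp: ass_def)

lemma assE:
  assumes "r \<in> ass R S"
  obtains s where "r \<in> carrier R" "s \<in> S" "s \<otimes> r = \<zero>"
  using assms by (auto simp: ass_def)

text \<open>
  The Ore condition is what makes the definition work: common left multiples of denominators give
  closure under sums, and moving an annihilator past \<open>x\<close> gives closure under left multiplication.
\<close>

lemma ass_ideal: "ideal (ass R S) R"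
proof (rule idealI)
  show "ring R" by (rule ring_axioms)
  have add: "r \<oplus> q \<in> ass R S" if r: "r \<in> ass R S" and q: "q \<in> ass R S" for r q
  proof -
    obtain s where s: "r \<in> carrier R" "s \<in> S" "s \<otimes> r = \<zero>" using r by (rule assE)
    obtain t where t: "q \<in> carrier R" "t \<in> S" "t \<otimes> q = \<zero>" using q by (rule assE)
    obtain c d where cd: "c \<in> S" "d \<in> carrier R" "c \<otimes> s = d \<otimes> t"
      using ore[OF denominator_carrier[OF s(2)] t(2)] .
    note carr = s(1) t(1) cd(2) s(2)[THEN denominator_carrier] t(2)[THEN denominator_carrier]
      cd(1)[THEN denominator_carrier]
    have "(c \<otimes> s) \<otimes> (r \<oplus> q) = (c \<otimes> s) \<otimes> r \<oplus> (d \<otimes> t) \<otimes> q"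
      using carr by (simp add: r_distr flip: cd(3))
    also have "\<dots> = \<zero>"
      using carr s(3) t(3) by (simp add: m_assoc)
    finally show ?thesis
      using carr by (intro assI[OF _ denominator_mult[OF cd(1) s(2)]]) auto
  qed
  have neg: "\<ominus> r \<in> ass R S" if "r \<in> ass R S" for r
    using that by (elim assE, intro assI) (auto simp: r_minus denominator_carrier)
  show "subgroup (ass R S) (add_monoid R)"
  proof (rule add.subgroupI)
    show "ass R S \<subseteq> carrier R" by (auto elim: assE)
    show "ass R S \<noteq> {}" using assI[of \<zero> \<one>] denominator_one by auto
  qed (use add neg in auto)
  show "x \<otimes> a \<in> ass R S" if a: "a \<in> ass R S" and x: "x \<in> carrier R" for a x
  proof -
    obtain s where s: "a \<in> carrier R" "s \<in> S" "s \<otimes> a = \<zero>" using a by (rule assE)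
    obtain c d where cd: "c \<in> S" "d \<in> carrier R" "c \<otimes> x = d \<otimes> s"
      using ore[OF x s(2)] .
    have "c \<otimes> (x \<otimes> a) = d \<otimes> (s \<otimes> a)"
      using s(1) x cd(2) cd(1)[THEN denominator_carrier] s(2)[THEN denominator_carrier] cd(3)
      by (metis m_assoc)
    then show ?thesis using s x cd by (intro assI[of _ c]) auto
  qed
  show "a \<otimes> x \<in> ass R S" if "a \<in> ass R S" and "x \<in> carrier R" for a x
    using that by (elim assE, intro assI) (auto simp: denominator_carrier simp flip: m_assoc)
qed

lemma ass_cancel_left:
  assumes "s \<in> S" "r \<in> carrier R" "s \<otimes> r \<in> ass R S"
  shows "r \<in> ass R S"
proof -
  obtain t where "t \<in> S" "t \<otimes> (s \<otimes> r) = \<zero>" using assms(3) by (rule assE)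
  then show ?thesis
    using assms by (intro assI[of _ "t \<otimes> s"]) (auto simp: denominator_mult denominator_carrier m_assoc)
qed

text \<open>
  This is the reversibility axiom carried over to \<open>R/ass S\<close>; with the previous lemma, denominators
  are regular modulo \<open>ass S\<close>.
\<close>

lemma ass_cancel_right:
  assumes "s \<in> S" "r \<in> carrier R" "r \<otimes> s \<in> ass R S"
  shows "r \<in> ass R S"
proof -
  obtain t where t: "t \<in> S" "t \<otimes> (r \<otimes> s) = \<zero>" using assms(3) by (rule assE)
  then have "t \<otimes> r \<in> ass R S"
    using assms by (intro reversible[of _ s]) (auto simp: denominator_carrier m_assoc)
  then show ?thesis using ass_cancel_left t assms by blast
qed

end

section \<open>Localizations that are quotients\<close>

text \<open>
  The operations of \<^const>\<open>localization\<close> are unions over all choices of representatives; they are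
  evaluated by showing that all choices give the same class.
\<close>

lemma Union_eq_unique_member: "(\<And>B. B \<in> A \<Longrightarrow> B = C) \<Longrightarrow> A \<noteq> {} \<Longrightarrow> \<Union>A = C"
  by auto

text \<open>
  A quotient of \<open>R\<close> by \<open>ass S\<close> in which the denominators are already invertible is a model of
  \<open>S\<inverse>R\<close>. The fraction with value \<open>v\<close> is then the solution set \<open>{(t, q). t v = q}\<close>, which replaces
  computations with Ore equivalence by computations in the ring \<open>Q\<close>. The target \<open>Q\<close> is a parameter
  because it is instantiated both with \<open>R/ass S\<close> and with the localization itself.
\<close>

locale inverting_quotient = denominator_set R S + ring_hom_ring R Q p
  for R (structure) and S and Q (structure) and p +
  assumes surjective: "p ` carrier R = carrier Q"
    and kernel: "r \<in> carrier R \<Longrightarrow> p r = \<zero>\<^bsub>Q\<^esub> \<longleftrightarrow> r \<in> ass R S"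
    and inverts: "s \<in> S \<Longrightarrow> p s \<in> Units Q"
begin

definition frac :: "'c \<Rightarrow> ('a \<times> 'a) set" where
  "frac v = {(t, q). t \<in> S \<and> q \<in> carrier R \<and> p t \<otimes>\<^bsub>Q\<^esub> v = p q}"

lemma p_eq_iff:
  assumes "r \<in> carrier R" "q \<in> carrier R"
  shows "p r = p q \<longleftrightarrow> r \<ominus> q \<in> ass R S"
proof -
  have "p r = p q \<longleftrightarrow> p (r \<ominus> q) = \<zero>\<^bsub>Q\<^esub>"
    using assms by (simp add: a_minus_def[of R] S.r_right_minus_eq flip: a_minus_def[of Q])
  then show ?thesis using assms by (simp add: kernel)
qed

lemma p_eq_iff_mult:
  assumes "r \<in> carrier R" "q \<in> carrier R"
  shows "p r = p q \<longleftrightarrow> (\<exists>c\<in>S. c \<otimes> r = c \<otimes> q)"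
proof -
  have "p r = p q \<longleftrightarrow> (\<exists>c\<in>S. c \<otimes> (r \<ominus> q) = \<zero>)"
    using assms by (simp add: p_eq_iff ass_def)
  also have "\<dots> \<longleftrightarrow> (\<exists>c\<in>S. c \<otimes> r = c \<otimes> q)"
  proof (rule bex_cong[OF refl])
    fix c assume "c \<in> S"
    then have "c \<otimes> (r \<ominus> q) = c \<otimes> r \<ominus> c \<otimes> q"
      using assms denominator_carrier[of c] by (simp add: R.minus_eq R.r_distr R.r_minus)
    then show "(c \<otimes> (r \<ominus> q) = \<zero>) = (c \<otimes> r = c \<otimes> q)"
      using assms \<open>c \<in> S\<close> denominator_carrier[of c] by simp
  qed
  finally show ?thesis .
qed

text \<open>
  Ore-equivalent pairs have the same value because \<open>dt \<in> S\<close> forces \<open>d\<close> to be a unit in \<open>Q\<close>.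
  Conversely, pairs of equal value have a common denominator by the Ore condition, with numerators
  that agree up to \<open>ass S\<close>; a further factor from \<open>S\<close> makes them equal.
\<close>

lemma lfrac_eq_frac:
  assumes s: "s \<in> S" and r: "r \<in> carrier R" and v: "v \<in> carrier Q" and eq: "p s \<otimes>\<^bsub>Q\<^esub> v = p r"
  shows "lfrac R S s r = frac v"
proof -
  have "(\<exists>c\<in>carrier R. \<exists>d\<in>carrier R. c \<otimes> s = d \<otimes> t \<and> c \<otimes> s \<in> S \<and> c \<otimes> r = d \<otimes> q)
      \<longleftrightarrow> p t \<otimes>\<^bsub>Q\<^esub> v = p q" (is "?L \<longleftrightarrow> ?R")
    if t: "t \<in> S" and q: "q \<in> carrier R" for t q
  proof
    assume ?L
    then obtain c d where cd: "c \<in> carrier R" "d \<in> carrier R" "c \<otimes> s = d \<otimes> t" "c \<otimes> s \<in> S"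
      "c \<otimes> r = d \<otimes> q" by blast
    note carr = cd(1,2) denominator_carrier[OF s] denominator_carrier[OF t] r q
    have "p d \<otimes>\<^bsub>Q\<^esub> (p t \<otimes>\<^bsub>Q\<^esub> v) = p (c \<otimes> s) \<otimes>\<^bsub>Q\<^esub> v"
      using carr v by (simp add: S.m_assoc cd(3))
    also have "\<dots> = p c \<otimes>\<^bsub>Q\<^esub> p r"
      using carr v eq by (simp add: S.m_assoc)
    also have "\<dots> = p d \<otimes>\<^bsub>Q\<^esub> p q"
      using carr cd(5) by (metis hom_mult)
    finally have "p d \<otimes>\<^bsub>Q\<^esub> (p t \<otimes>\<^bsub>Q\<^esub> v) = p d \<otimes>\<^bsub>Q\<^esub> p q" .
    moreover have "p d \<in> Units Q"
    proof -
      have "p d = p (d \<otimes> t) \<otimes>\<^bsub>Q\<^esub> inv\<^bsub>Q\<^esub> p t"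
        using carr inverts[OF t] by (simp add: S.m_assoc)
      then show ?thesis using inverts t cd(3,4) by auto
    qed
    ultimately show ?R using carr v by simp
  next
    assume ?R
    obtain c d where cd: "c \<in> S" "d \<in> carrier R" "c \<otimes> s = d \<otimes> t"
      using ore[OF denominator_carrier[OF s] t] .
    note carr = denominator_carrier[OF cd(1)] cd(2) denominator_carrier[OF s]
      denominator_carrier[OF t] r q
    have "p (c \<otimes> r) = p (c \<otimes> s) \<otimes>\<^bsub>Q\<^esub> v"
      using carr v by (simp add: S.m_assoc eq)
    also have "\<dots> = p (d \<otimes> q)"
      using carr v \<open>?R\<close> by (simp add: cd(3) S.m_assoc)
    finally obtain b where b: "b \<in> S" "b \<otimes> (c \<otimes> r) = b \<otimes> (d \<otimes> q)"
      using p_eq_iff_mult[of "c \<otimes> r" "d \<otimes> q"] carr by auto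
    note carr = carr denominator_carrier[OF b(1)]
    show ?L
    proof (intro bexI conjI)
      show "b \<otimes> c \<otimes> s = b \<otimes> d \<otimes> t" using cd(3) carr by (simp add: R.m_assoc)
      show "b \<otimes> c \<otimes> s \<in> S" using b cd s by (simp add: denominator_mult)
      show "b \<otimes> c \<otimes> r = b \<otimes> d \<otimes> q" using b carr by (simp add: R.m_assoc)
    qed (use carr in auto)
  qed
  then show ?thesis
    by (simp add: lfrac_def frac_def cong: conj_cong)
qed

lemma lfrac_eq_frac_inv:
  assumes "s \<in> S" "r \<in> carrier R"
  shows "lfrac R S s r = frac (inv\<^bsub>Q\<^esub> p s \<otimes>\<^bsub>Q\<^esub> p r)"
  using assms inverts[of s]
  by (intro lfrac_eq_frac) (auto simp: denominator_carrier simp flip: S.m_assoc)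

lemma loc_can_eq_frac: "r \<in> carrier R \<Longrightarrow> loc_can R S r = frac (p r)"
  unfolding loc_can_def by (intro lfrac_eq_frac) (auto simp: denominator_one)

text \<open>
  An idempotent that becomes invertible becomes \<open>1\<close>, so it disappears as a denominator.
\<close>

lemma lfrac_idempotent_denominator:
  assumes s: "s \<in> S" "s \<otimes> s = s" and r: "r \<in> carrier R"
  shows "lfrac R S s r = loc_can R S r"
proof -
  have carr: "s \<in> carrier R" using s by (simp add: denominator_carrier)
  have "p (s \<otimes> r) = p r"
    using s r carr by (subst p_eq_iff_mult) (auto intro!: bexI[of _ s] simp flip: R.m_assoc)
  then show ?thesis
    using s r carr by (simp add: loc_can_eq_frac lfrac_eq_frac)
qed

lemma frac_mem:
  assumes "v \<in> carrier Q" obtains q where "q \<in> carrier R" "p q = v" "(\<one>, q) \<in> frac v"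
proof -
  obtain q where "q \<in> carrier R" "p q = v" using assms by (auto simp flip: surjective)
  then show thesis using that denominator_one by (auto simp: frac_def)
qed

lemma frac_inj:
  assumes "v \<in> carrier Q" "w \<in> carrier Q" "frac v = frac w" shows "v = w"
proof -
  obtain q where "q \<in> carrier R" "p q = v" "(\<one>, q) \<in> frac v" using assms(1) by (rule frac_mem)
  then have "(\<one>, q) \<in> frac w" "v = p q" using assms by auto
  then show ?thesis using assms by (simp add: frac_def)
qed

lemma frac_carrier: "frac ` carrier Q = carrier (localization R S)"
proof -
  have "carrier (localization R S) = {lfrac R S s r | s r. s \<in> S \<and> r \<in> carrier R}"
    by (simp add: localization_def)
  also have "\<dots> = frac ` carrier Q"
  proof (intro equalityI subsetI)
    fix V assume "V \<in> {lfrac R S s r | s r. s \<in> S \<and> r \<in> carrier R}"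
    then obtain s r where sr: "s \<in> S" "r \<in> carrier R" "V = lfrac R S s r" by blast
    then show "V \<in> frac ` carrier Q"
      using inverts[OF sr(1)] by (auto simp: lfrac_eq_frac_inv)
  next
    fix V assume "V \<in> frac ` carrier Q"
    then obtain r where "r \<in> carrier R" "V = frac (p r)" by (auto simp flip: surjective)
    then show "V \<in> {lfrac R S s r | s r. s \<in> S \<and> r \<in> carrier R}"
      using loc_can_eq_frac denominator_one unfolding loc_can_def by auto
  qed
  finally show ?thesis ..
qed

lemma frac_mult:
  assumes v: "v \<in> carrier Q" and w: "w \<in> carrier Q"
  shows "frac v \<otimes>\<^bsub>localization R S\<^esub> frac w = frac (v \<otimes>\<^bsub>Q\<^esub> w)"
proof -
  let ?X = "{lfrac R S (c \<otimes> s) (d \<otimes> q) | s r t q c d.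
              (s, r) \<in> frac v \<and> (t, q) \<in> frac w \<and> c \<in> S \<and> d \<in> carrier R \<and> c \<otimes> r = d \<otimes> t}"
  have "V = frac (v \<otimes>\<^bsub>Q\<^esub> w)" if "V \<in> ?X" for V
  proof -
    obtain s r t q c d where V: "V = lfrac R S (c \<otimes> s) (d \<otimes> q)"
      and sr: "s \<in> S" "r \<in> carrier R" "p s \<otimes>\<^bsub>Q\<^esub> v = p r"
      and tq: "t \<in> S" "q \<in> carrier R" "p t \<otimes>\<^bsub>Q\<^esub> w = p q"
      and cd: "c \<in> S" "d \<in> carrier R" "c \<otimes> r = d \<otimes> t"
      using \<open>V \<in> ?X\<close> unfolding frac_def by auto
    note carr = sr(2) tq(2) cd(2) sr(1)[THEN denominator_carrier] tq(1)[THEN denominator_carrier]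
      cd(1)[THEN denominator_carrier]
    have "p (c \<otimes> s) \<otimes>\<^bsub>Q\<^esub> (v \<otimes>\<^bsub>Q\<^esub> w) = p c \<otimes>\<^bsub>Q\<^esub> (p s \<otimes>\<^bsub>Q\<^esub> v) \<otimes>\<^bsub>Q\<^esub> w"
      using carr v w by (simp add: S.m_assoc)
    also have "\<dots> = p (c \<otimes> r) \<otimes>\<^bsub>Q\<^esub> w" using carr sr by simp
    also have "\<dots> = p (d \<otimes> q)" using carr w tq by (simp add: cd(3) S.m_assoc)
    finally show ?thesis
      unfolding V using carr v w cd sr by (intro lfrac_eq_frac) (auto simp: denominator_mult)
  qed
  moreover have "?X \<noteq> {}"
  proof -
    obtain r where r: "r \<in> carrier R" "(\<one>, r) \<in> frac v" using v by (rule frac_mem)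
    obtain q where q: "q \<in> carrier R" "(\<one>, q) \<in> frac w" using w by (rule frac_mem)
    have "\<one> \<otimes> r = r \<otimes> \<one>" using r by simp
    then show ?thesis using r q denominator_one by blast
  qed
  ultimately have "\<Union>?X = frac (v \<otimes>\<^bsub>Q\<^esub> w)" by (rule Union_eq_unique_member)
  then show ?thesis by (simp add: localization_def)
qed

lemma frac_add:
  assumes v: "v \<in> carrier Q" and w: "w \<in> carrier Q"
  shows "frac v \<oplus>\<^bsub>localization R S\<^esub> frac w = frac (v \<oplus>\<^bsub>Q\<^esub> w)"
proof -
  let ?X = "{lfrac R S (c \<otimes> s) (c \<otimes> r \<oplus> d \<otimes> q) | s r t q c d.
              (s, r) \<in> frac v \<and> (t, q) \<in> frac w \<and> c \<in> carrier R \<and> d \<in> carrier R \<and>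
              c \<otimes> s = d \<otimes> t \<and> c \<otimes> s \<in> S}"
  have "V = frac (v \<oplus>\<^bsub>Q\<^esub> w)" if "V \<in> ?X" for V
  proof -
    obtain s r t q c d where V: "V = lfrac R S (c \<otimes> s) (c \<otimes> r \<oplus> d \<otimes> q)"
      and sr: "s \<in> S" "r \<in> carrier R" "p s \<otimes>\<^bsub>Q\<^esub> v = p r"
      and tq: "t \<in> S" "q \<in> carrier R" "p t \<otimes>\<^bsub>Q\<^esub> w = p q"
      and cd: "c \<in> carrier R" "d \<in> carrier R" "c \<otimes> s = d \<otimes> t" "c \<otimes> s \<in> S"
      using \<open>V \<in> ?X\<close> unfolding frac_def by auto
    note carr = sr(2) tq(2) cd(1,2) sr(1)[THEN denominator_carrier] tq(1)[THEN denominator_carrier]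
    have "p (c \<otimes> s) \<otimes>\<^bsub>Q\<^esub> (v \<oplus>\<^bsub>Q\<^esub> w) = p (c \<otimes> s) \<otimes>\<^bsub>Q\<^esub> v \<oplus>\<^bsub>Q\<^esub> p (d \<otimes> t) \<otimes>\<^bsub>Q\<^esub> w"
      using carr v w cd(3) by (simp add: S.r_distr)
    also have "\<dots> = p (c \<otimes> r \<oplus> d \<otimes> q)"
      using carr v w sr(3) tq(3) by (simp add: S.m_assoc)
    finally show ?thesis
      unfolding V using carr v w cd sr by (intro lfrac_eq_frac) auto
  qed
  moreover have "?X \<noteq> {}"
  proof -
    obtain r where r: "r \<in> carrier R" "(\<one>, r) \<in> frac v" using v by (rule frac_mem)
    obtain q where q: "q \<in> carrier R" "(\<one>, q) \<in> frac w" using w by (rule frac_mem)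
    have "\<one> \<otimes> \<one> \<in> S" using denominator_one by simp
    then show ?thesis using r q R.one_closed by blast
  qed
  ultimately have "\<Union>?X = frac (v \<oplus>\<^bsub>Q\<^esub> w)" by (rule Union_eq_unique_member)
  then show ?thesis by (simp add: localization_def)
qed

lemma localization_one_zero:
  "\<one>\<^bsub>localization R S\<^esub> = frac \<one>\<^bsub>Q\<^esub>" "\<zero>\<^bsub>localization R S\<^esub> = frac \<zero>\<^bsub>Q\<^esub>"
  using loc_can_eq_frac[of \<one>] loc_can_eq_frac[of \<zero>]
  by (simp_all add: localization_def loc_can_def)

lemma frac_iso: "frac \<in> ring_iso Q (localization R S)"
proof (rule ring_iso_memI)
  show "bij_betw frac (carrier Q) (carrier (localization R S))"
    by (intro bij_betw_imageI frac_carrier inj_onI frac_inj)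
  then show "frac v \<in> carrier (localization R S)" if "v \<in> carrier Q" for v
    using that by (auto simp: bij_betw_def)
qed (simp_all add: frac_mult frac_add localization_one_zero)

lemma localization_ring: "ring (localization R S)"
  using S.ring_iso_imp_img_ring[OF frac_iso] by (simp flip: localization_one_zero)

text \<open>
  The isomorphism \<open>S\<inverse>R \<cong> R/ass S\<close> under \<open>R\<close>, once \<open>Q\<close> is the factor ring.
\<close>

lemma quotient_iso:
  "\<exists>h \<in> ring_iso (localization R S) Q. \<forall>r\<in>carrier R. h (loc_can R S r) = p r"
proof (intro bexI ballI)
  show "inv_into (carrier Q) frac \<in> ring_iso (localization R S) Q"
    by (rule ring_iso_set_sym[OF S.ring_axioms frac_iso])
  show "inv_into (carrier Q) frac (loc_can R S r) = p r" if "r \<in> carrier R" for r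
    using that loc_can_eq_frac frac_inj by (auto intro!: inv_into_f_eq inj_onI)
qed

lemma loc_can_mult_lfrac:
  assumes "s \<in> S" "r \<in> carrier R"
  shows "lfrac R S s r \<in> carrier (localization R S)"
    and "loc_can R S s \<otimes>\<^bsub>localization R S\<^esub> lfrac R S s r = loc_can R S r"
proof -
  show "lfrac R S s r \<in> carrier (localization R S)"
    using assms by (auto simp: localization_def)
  show "loc_can R S s \<otimes>\<^bsub>localization R S\<^esub> lfrac R S s r = loc_can R S r"
    using assms inverts[of s] denominator_carrier[of s]
    by (simp add: loc_can_eq_frac lfrac_eq_frac_inv frac_mult flip: S.m_assoc)
qed

text \<open>
  Being a model of itself, the localization can be handled through the properties of \<^const>\<open>loc_can\<close>
  alone: a surjective homomorphism with kernel \<open>ass S\<close> that inverts \<open>S\<close>.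
\<close>

lemma localization_inverting_quotient:
  "inverting_quotient R S (localization R S) (loc_can R S)"
proof (intro inverting_quotient.intro ring_hom_ring.intro ring_hom_ring_axioms.intro
    inverting_quotient_axioms.intro)
  show "denominator_set R S" "ring R" "ring (localization R S)"
    by (rule denominator_set_axioms R.ring_axioms localization_ring)+
  have frac_closed: "frac v \<in> carrier (localization R S)" if "v \<in> carrier Q" for v
    using that by (simp flip: frac_carrier)
  then show "loc_can R S \<in> ring_hom R (localization R S)"
    by (intro ring_hom_memI)
      (simp_all add: loc_can_eq_frac frac_mult frac_add localization_one_zero)
  have "loc_can R S ` carrier R = frac ` p ` carrier R"
    by (simp add: image_image loc_can_eq_frac cong: image_cong)
  then show "loc_can R S ` carrier R = carrier (localization R S)"
    by (simp add: surjective frac_carrier)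
  show "loc_can R S r = \<zero>\<^bsub>localization R S\<^esub> \<longleftrightarrow> r \<in> ass R S" if "r \<in> carrier R" for r
  proof -
    have "frac (p r) = frac \<zero>\<^bsub>Q\<^esub> \<longleftrightarrow> p r = \<zero>\<^bsub>Q\<^esub>"
      using that frac_inj[of "p r" "\<zero>\<^bsub>Q\<^esub>"] by auto
    then show ?thesis
      using that by (simp add: loc_can_eq_frac localization_one_zero kernel)
  qed
  show "loc_can R S s \<in> Units (localization R S)" if s: "s \<in> S" for s
    unfolding Units_def
  proof (intro CollectI conjI bexI)
    show "frac (inv\<^bsub>Q\<^esub> p s) \<in> carrier (localization R S)" "loc_can R S s \<in> carrier (localization R S)"
      using inverts[OF s] denominator_carrier[OF s] by (simp_all add: frac_closed loc_can_eq_frac)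
    show "frac (inv\<^bsub>Q\<^esub> p s) \<otimes>\<^bsub>localization R S\<^esub> loc_can R S s = \<one>\<^bsub>localization R S\<^esub>"
      "loc_can R S s \<otimes>\<^bsub>localization R S\<^esub> frac (inv\<^bsub>Q\<^esub> p s) = \<one>\<^bsub>localization R S\<^esub>"
      using inverts[OF s] denominator_carrier[OF s]
      by (simp_all add: loc_can_eq_frac frac_mult localization_one_zero)
  qed
qed

end

section \<open>Comparing localizations\<close>

text \<open>
  When all localizations are quotients of \<open>R\<close>, comparing them is comparing kernels.
\<close>

context
  fixes R (structure) and S T
  assumes locS: "inverting_quotient R S (localization R S) (loc_can R S)"
    and locT: "inverting_quotient R T (localization R T) (loc_can R T)"
begin

interpretation S: inverting_quotient R S "localization R S" "loc_can R S" by (rule locS)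
interpretation T: inverting_quotient R T "localization R T" "loc_can R T" by (rule locT)

lemma fraction_map_loc_can:
  assumes h: "fraction_map R S T h" and r: "r \<in> carrier R"
  shows "h (loc_can R S r) = loc_can R T r"
proof -
  have "h (loc_can R S r) =
      inv\<^bsub>localization R T\<^esub> (loc_can R T \<one>) \<otimes>\<^bsub>localization R T\<^esub> loc_can R T r"
    using h r S.denominator_one unfolding fraction_map_def loc_can_def by blast
  then show ?thesis using r by simp
qed

lemma fraction_map_imp_ass_subset:
  assumes h: "fraction_map R S T h"
  shows "ass R S \<subseteq> ass R T"
proof
  fix r assume r: "r \<in> ass R S"
  then have carr: "r \<in> carrier R" by (simp add: ass_def)
  have "loc_can R T r = h (loc_can R S r)" using fraction_map_loc_can[OF h carr] ..
  also have "\<dots> = h (loc_can R S \<zero>)" using S.kernel[OF carr] r by simp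
  also have "\<dots> = \<zero>\<^bsub>localization R T\<^esub>" using fraction_map_loc_can[OF h, of \<zero>] by simp
  finally show "r \<in> ass R T" using carr by (simp add: T.kernel)
qed

text \<open>
  The map is the one induced on quotients of \<open>R\<close>. Every equation between images in \<open>S\<inverse>R\<close> persists
  in \<open>T\<inverse>R\<close>, in particular the two equations stating that \<open>s \<in> S\<close> has an inverse, and the equation
  that characterizes \<open>s\<inverse>r\<close>.
\<close>

lemma ass_subset_imp_fraction_map:
  assumes sub: "ass R S \<subseteq> ass R T"
  obtains h where "fraction_map R S T h"
    and "\<And>r. r \<in> carrier R \<Longrightarrow> h (loc_can R S r) = loc_can R T r"
proof
  define h where "h V = loc_can R T (inv_into (carrier R) (loc_can R S) V)" for V
  have transfer: "loc_can R T r = loc_can R T q"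
    if "loc_can R S r = loc_can R S q" "r \<in> carrier R" "q \<in> carrier R" for r q
    using that sub by (auto simp: S.p_eq_iff T.p_eq_iff)
  have lift: "\<exists>w\<in>carrier R. loc_can R S w = V" if "V \<in> carrier (localization R S)" for V
    using that by (auto simp flip: S.surjective)
  show h: "h (loc_can R S r) = loc_can R T r" if r: "r \<in> carrier R" for r
    unfolding h_def using r by (intro transfer f_inv_into_f inv_into_into) auto
  have unit: "loc_can R T s \<in> Units (localization R T)" if s: "s \<in> S" for s
  proof -
    have carr: "s \<in> carrier R" using s by (rule S.denominator_carrier)
    obtain V where V: "V \<in> carrier (localization R S)"
      "V \<otimes>\<^bsub>localization R S\<^esub> loc_can R S s = \<one>\<^bsub>localization R S\<^esub>"
      "loc_can R S s \<otimes>\<^bsub>localization R S\<^esub> V = \<one>\<^bsub>localization R S\<^esub>"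
      using S.inverts[OF s] unfolding Units_def by auto
    obtain y where y: "y \<in> carrier R" "loc_can R S y = V" using lift[OF V(1)] by blast
    have "loc_can R S (y \<otimes> s) = loc_can R S \<one>" "loc_can R S (s \<otimes> y) = loc_can R S \<one>"
      using V y carr by simp_all
    then have "loc_can R T (y \<otimes> s) = loc_can R T \<one>" "loc_can R T (s \<otimes> y) = loc_can R T \<one>"
      using transfer[of "y \<otimes> s" \<one>] transfer[of "s \<otimes> y" \<one>] y(1) carr by simp_all
    then show ?thesis
      unfolding Units_def using y(1) carr
      by (intro CollectI conjI bexI[of _ "loc_can R T y"]) simp_all
  qed
  show "fraction_map R S T h"
    unfolding fraction_map_def
  proof (intro conjI ballI)
    show "h \<in> carrier (localization R S) \<rightarrow> carrier (localization R T)"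
      using lift h by fastforce
    fix s r assume s: "s \<in> S" and r: "r \<in> carrier R"
    have carr: "s \<in> carrier R" using s by (rule S.denominator_carrier)
    obtain w where w: "w \<in> carrier R" "loc_can R S w = lfrac R S s r"
      using lift[OF S.loc_can_mult_lfrac(1)[OF s r]] by blast
    have "loc_can R S (s \<otimes> w) = loc_can R S r"
      using w carr S.loc_can_mult_lfrac(2)[OF s r] by simp
    then have "loc_can R T r = loc_can R T s \<otimes>\<^bsub>localization R T\<^esub> loc_can R T w"
      using transfer[of "s \<otimes> w" r] w carr r by simp
    then show "h (lfrac R S s r) =
        inv\<^bsub>localization R T\<^esub> loc_can R T s \<otimes>\<^bsub>localization R T\<^esub> loc_can R T r"
      using unit[OF s] w carr h[of w] by (simp flip: T.S.m_assoc)
  qed (rule unit)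
qed

lemma fraction_map_iff: "(\<exists>h. fraction_map R S T h) \<longleftrightarrow> ass R S \<subseteq> ass R T"
  using fraction_map_imp_ass_subset ass_subset_imp_fraction_map by metis

text \<open>
  Injectivity of the map supplies the inclusion of kernels that its existence does not.
\<close>

lemma R_isomorphic_iff: "R_isomorphic R S T \<longleftrightarrow> ass R S = ass R T"
proof
  assume "R_isomorphic R S T"
  then obtain h where iso: "h \<in> ring_iso (localization R S) (localization R T)"
    and h: "fraction_map R S T h" unfolding R_isomorphic_def by blast
  have "r \<in> ass R S" if r: "r \<in> ass R T" for r
  proof -
    have carr: "r \<in> carrier R" using r by (simp add: ass_def)
    have "h (loc_can R S r) = h (loc_can R S \<zero>)"
      using fraction_map_loc_can[OF h carr] fraction_map_loc_can[OF h, of \<zero>] T.kernel[OF carr] r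
      by simp
    then have "loc_can R S r = loc_can R S \<zero>"
      by (rule inj_onD[OF bij_betw_imp_inj_on[OF ring_iso_memE(5)[OF iso]]]) (use carr in simp_all)
    then show ?thesis using carr by (simp add: S.kernel)
  qed
  then show "ass R S = ass R T" using fraction_map_imp_ass_subset[OF h] by blast
next
  assume eq: "ass R S = ass R T"
  then obtain h where h: "fraction_map R S T h"
    and can: "\<And>r. r \<in> carrier R \<Longrightarrow> h (loc_can R S r) = loc_can R T r"
    using ass_subset_imp_fraction_map by blast
  have carrS: "carrier (localization R S) = loc_can R S ` carrier R"
    and carrT: "carrier (localization R T) = loc_can R T ` carrier R"
    by (simp_all add: S.surjective T.surjective)
  have can_mult: "h (loc_can R S r \<otimes>\<^bsub>localization R S\<^esub> loc_can R S q) =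
      loc_can R T r \<otimes>\<^bsub>localization R T\<^esub> loc_can R T q"
    and can_add: "h (loc_can R S r \<oplus>\<^bsub>localization R S\<^esub> loc_can R S q) =
      loc_can R T r \<oplus>\<^bsub>localization R T\<^esub> loc_can R T q"
    if "r \<in> carrier R" "q \<in> carrier R" for r q
    using that can[of "r \<otimes> q"] can[of "r \<oplus> q"] by simp_all
  have can_one: "h \<one>\<^bsub>localization R S\<^esub> = \<one>\<^bsub>localization R T\<^esub>"
    using can[of \<one>] by simp
  have "h \<in> ring_iso (localization R S) (localization R T)"
  proof (rule ring_iso_memI)
    show "bij_betw h (carrier (localization R S)) (carrier (localization R T))"
    proof (rule bij_betw_imageI)
      show "inj_on h (carrier (localization R S))"
        unfolding carrS
        by (intro inj_onI, elim imageE, hypsubst) (simp add: can S.p_eq_iff T.p_eq_iff eq)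
      show "h ` carrier (localization R S) = carrier (localization R T)"
        unfolding carrS carrT by (simp add: image_image can cong: image_cong)
    qed
  qed (auto simp: carrS carrT can can_mult can_add can_one)
  then show "R_isomorphic R S T" using h unfolding R_isomorphic_def by blast
qed

end

section \<open>Idempotents with vanishing corner\<close>

context ring
begin

text \<open>
  By the decomposition \<open>r = er + (1 - e)r\<close>. As an annihilator, \<open>(1 - e)R\<close> can be compared with \<open>ass S\<close>.
\<close>

lemma compl_ideal_eq_annihilator:
  assumes e: "e \<in> carrier R" "e \<otimes> e = e"
  shows "compl_ideal R e = {r \<in> carrier R. e \<otimes> r = \<zero>}"
proof (intro equalityI subsetI)
  fix x assume "x \<in> compl_ideal R e"
  then obtain r where r: "r \<in> carrier R" "x = (\<one> \<ominus> e) \<otimes> r"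
    unfolding compl_ideal_def l_coset_def by blast
  have "e \<otimes> x = (e \<ominus> e \<otimes> e) \<otimes> r"
    using e(1) r by (simp add: a_minus_def l_distr r_distr l_minus r_minus m_assoc)
  also have "\<dots> = \<zero>" using e r(1) by (simp add: a_minus_def r_neg)
  finally show "x \<in> {r \<in> carrier R. e \<otimes> r = \<zero>}" using e r by simp
next
  fix x assume x: "x \<in> {r \<in> carrier R. e \<otimes> r = \<zero>}"
  then have "(\<one> \<ominus> e) \<otimes> x = x \<ominus> e \<otimes> x"
    using e(1) by (simp add: a_minus_def l_distr l_minus)
  then have "x = (\<one> \<ominus> e) \<otimes> x" using x by (simp add: a_minus_def)
  then show "x \<in> compl_ideal R e"
    unfolding compl_ideal_def l_coset_def using x by blast
qed

lemma mult_compl_eq_zero_iff: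
  assumes "a \<in> carrier R" "e \<in> carrier R"
  shows "a \<otimes> (\<one> \<ominus> e) = \<zero> \<longleftrightarrow> a \<otimes> e = a"
proof -
  have "a \<otimes> (\<one> \<ominus> e) = a \<ominus> a \<otimes> e"
    using assms by (simp add: a_minus_def r_distr r_minus)
  then show ?thesis using assms by auto
qed

text \<open>
  The condition \<open>eR(1 - e) = 0\<close> is used in the form \<open>ere = er\<close>. It follows from reversibility applied to
  \<open>r(1 - e)e = 0\<close>. Conversely it supplies the Ore condition, through \<open>er = (er)e\<close>, and reversibility,
  since \<open>re = 0\<close> gives \<open>er = ere = 0\<close>.
\<close>

lemma idempotent_denominator_set_iff:
  assumes e: "e \<in> carrier R" "e \<otimes> e = e" "e \<noteq> \<zero>" and one: "\<one> \<noteq> \<zero>"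
  shows "S_idem R e \<in> Den_l R \<longleftrightarrow> (\<forall>r\<in>carrier R. e \<otimes> r \<otimes> e = e \<otimes> r)"
proof
  assume "S_idem R e \<in> Den_l R"
  then interpret denominator_set R "S_idem R e" by unfold_locales (simp add: Den_l_def)
  show "\<forall>r\<in>carrier R. e \<otimes> r \<otimes> e = e \<otimes> r"
  proof
    fix r assume r: "r \<in> carrier R"
    have "(\<one> \<ominus> e) \<otimes> e = \<zero>" using e by (simp add: a_minus_def l_distr l_minus r_neg)
    then have "r \<otimes> (\<one> \<ominus> e) \<otimes> e = \<zero>" using e r by (simp add: m_assoc)
    then have "r \<otimes> (\<one> \<ominus> e) \<in> ass R (S_idem R e)"
      using e r by (intro reversible[of _ e]) (auto simp: S_idem_def)
    then have "e \<otimes> (r \<otimes> (\<one> \<ominus> e)) = \<zero>"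
      using e r by (auto simp: ass_def S_idem_def)
    then show "e \<otimes> r \<otimes> e = e \<otimes> r"
      using e r by (simp add: mult_compl_eq_zero_iff flip: m_assoc)
  qed
next
  assume corner: "\<forall>r\<in>carrier R. e \<otimes> r \<otimes> e = e \<otimes> r"
  have "multiplicative_set R (S_idem R e)"
    using e one by (auto simp: multiplicative_set_def S_idem_def)
  moreover have "\<exists>x. x \<in> {t \<otimes> r | t. t \<in> S_idem R e} \<inter> {q \<otimes> s | q. q \<in> carrier R}"
    if r: "r \<in> carrier R" and s: "s \<in> S_idem R e" for r s
    using s
    unfolding S_idem_def
  proof (elim insertE emptyE)
    assume "s = \<one>"
    then show "\<exists>x. x \<in> {t \<otimes> r | t. t \<in> {\<one>, e}} \<inter> {q \<otimes> s | q. q \<in> carrier R}"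
      using r by (intro exI[of _ r]) (auto intro: exI[of _ \<one>] exI[of _ r])
  next
    assume "s = e"
    then show "\<exists>x. x \<in> {t \<otimes> r | t. t \<in> {\<one>, e}} \<inter> {q \<otimes> s | q. q \<in> carrier R}"
    proof (intro exI IntI)
      show "e \<otimes> r \<in> {t \<otimes> r | t. t \<in> {\<one>, e}}" by blast
      have "e \<otimes> r = (e \<otimes> r) \<otimes> s" "e \<otimes> r \<in> carrier R"
        using \<open>s = e\<close> e r corner by simp_all
      then show "e \<otimes> r \<in> {q \<otimes> s | q. q \<in> carrier R}" by blast
    qed
  qed
  moreover have "\<exists>t\<in>S_idem R e. t \<otimes> r = \<zero>"
    if r: "r \<in> carrier R" and s: "s \<in> S_idem R e" "r \<otimes> s = \<zero>" for r s
  proof -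
    have "e \<otimes> r = \<zero>"
      using s(1) unfolding S_idem_def
    proof (elim insertE emptyE)
      assume "s = \<one>" then show ?thesis using s r e by simp
    next
      assume "s = e"
      then have "e \<otimes> r \<otimes> e = \<zero>" using s r e by (simp add: m_assoc)
      then show ?thesis using corner r by simp
    qed
    then show ?thesis by (auto simp: S_idem_def)
  qed
  ultimately have "left_denominator_set R (S_idem R e)"
    unfolding left_denominator_set_def left_Ore_set_def by blast
  then show "S_idem R e \<in> Den_l R" by (simp add: Den_l_def)
qed

lemma ass_idempotent:
  assumes e: "e \<in> carrier R" "e \<otimes> e = e"
  shows "ass R (S_idem R e) = compl_ideal R e"
  using e by (auto simp: compl_ideal_eq_annihilator ass_def S_idem_def)

lemma compl_mem_compl_ideal:
  assumes e: "e \<in> carrier R"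
  shows "\<one> \<ominus> e \<in> compl_ideal R e"
  using e unfolding compl_ideal_def l_coset_def by (auto intro!: bexI[of _ \<one>])

text \<open>
  The pre-order on idempotents is inclusion of kernels, so \<open>\<sim>\<close> is equality of kernels.
\<close>

lemma compl_ideal_subset_iff:
  assumes e: "e \<in> carrier R" "e \<otimes> e = e" and f: "f \<in> carrier R" "f \<otimes> f = f"
  shows "compl_ideal R e \<subseteq> compl_ideal R f \<longleftrightarrow> idem_ge R e f"
proof
  assume "compl_ideal R e \<subseteq> compl_ideal R f"
  then have "f \<otimes> (\<one> \<ominus> e) = \<zero>"
    using compl_mem_compl_ideal[OF e(1)] by (auto simp: compl_ideal_eq_annihilator[OF f])
  then show "idem_ge R e f" using e f by (simp add: mult_compl_eq_zero_iff idem_ge_def)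
next
  assume ge: "idem_ge R e f"
  have "f \<otimes> r = \<zero>" if r: "r \<in> carrier R" "e \<otimes> r = \<zero>" for r
    using ge e f r m_assoc[of f e r] by (simp add: idem_ge_def)
  then show "compl_ideal R e \<subseteq> compl_ideal R f"
    by (auto simp: compl_ideal_eq_annihilator[OF f] compl_ideal_eq_annihilator[OF e])
qed

lemma I_l_iff:
  assumes "\<one> \<noteq> \<zero>"
  shows "e \<in> I_l R \<longleftrightarrow> e \<in> carrier R \<and> e \<otimes> e = e \<and> e \<noteq> \<zero> \<and> (\<forall>r\<in>carrier R. e \<otimes> r \<otimes> e = e \<otimes> r)"
  using idempotent_denominator_set_iff[of e] assms unfolding I_l_def by blast

end

context ring
begin

lemma idem_ge_iff_compl_ideal:
  assumes "\<one> \<noteq> \<zero>" "e \<in> I_l R" "f \<in> I_l R"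
  shows "idem_ge R e f \<longleftrightarrow> compl_ideal R e \<subseteq> compl_ideal R f"
  using assms by (simp add: I_l_iff compl_ideal_subset_iff)

lemma mem_idem_class_iff:
  assumes nz: "\<one> \<noteq> \<zero>" and e: "e \<in> I_l R"
  shows "f \<in> idem_class R e \<longleftrightarrow> f \<in> I_l R \<and> compl_ideal R e = compl_ideal R f"
  using e idem_ge_iff_compl_ideal[OF nz] unfolding idem_class_def idem_sim_def by blast

lemma idem_class_eq_iff:
  assumes nz: "\<one> \<noteq> \<zero>" and e: "e \<in> I_l R" and f: "f \<in> I_l R"
  shows "idem_class R e = idem_class R f \<longleftrightarrow> compl_ideal R e = compl_ideal R f"
proof
  assume "idem_class R e = idem_class R f"
  then show "compl_ideal R e = compl_ideal R f"
    using mem_idem_class_iff[OF nz e, of f] mem_idem_class_iff[OF nz f, of f] f by simp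
next
  assume "compl_ideal R e = compl_ideal R f"
  then show "idem_class R e = idem_class R f"
    using e f by (simp add: set_eq_iff mem_idem_class_iff[OF nz])
qed

text \<open>
  The relation between classes may be tested on any representatives, because equivalent idempotents
  have the same kernel.
\<close>

lemma class_ge_iff_compl_ideal:
  assumes nz: "\<one> \<noteq> \<zero>" and e: "e \<in> I_l R" and f: "f \<in> I_l R"
  shows "class_ge R (idem_class R e) (idem_class R f) \<longleftrightarrow> compl_ideal R e \<subseteq> compl_ideal R f"
proof
  assume "class_ge R (idem_class R e) (idem_class R f)"
  then obtain e' f' where "e' \<in> idem_class R e" "f' \<in> idem_class R f" "idem_ge R e' f'"
    unfolding class_ge_def by blast
  then show "compl_ideal R e \<subseteq> compl_ideal R f"
    using e f by (simp add: mem_idem_class_iff[OF nz] idem_ge_iff_compl_ideal[OF nz])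
next
  assume "compl_ideal R e \<subseteq> compl_ideal R f"
  then show "class_ge R (idem_class R e) (idem_class R f)"
    using e f unfolding class_ge_def
    by (intro bexI[of _ e] bexI[of _ f])
      (simp_all add: mem_idem_class_iff[OF nz] idem_ge_iff_compl_ideal[OF nz])
qed

end

section \<open>Left denominator sets of left Artinian rings\<close>

context ring
begin

lemma left_idealI:
  assumes "I \<subseteq> carrier R" "\<zero> \<in> I"
    and "\<And>a b. \<lbrakk>a \<in> I; b \<in> I\<rbrakk> \<Longrightarrow> a \<oplus> b \<in> I"
    and "\<And>r a. \<lbrakk>r \<in> carrier R; a \<in> I\<rbrakk> \<Longrightarrow> r \<otimes> a \<in> I"
  shows "left_ideal I R"
  unfolding left_ideal_def
proof (intro conjI ballI additive_subgroupI add.subgroupI)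
  show "\<ominus> a \<in> I" if a: "a \<in> I" for a
  proof -
    have "(\<ominus> \<one>) \<otimes> a = \<ominus> a" using a assms(1) by (auto simp: l_minus)
    then show ?thesis using assms(4)[of "\<ominus> \<one>" a] a by simp
  qed
qed (use assms in auto)

lemma left_idealD:
  assumes "left_ideal I R"
  shows "I \<subseteq> carrier R" "\<zero> \<in> I"
    and "\<And>a b. \<lbrakk>a \<in> I; b \<in> I\<rbrakk> \<Longrightarrow> a \<oplus> b \<in> I"
    and "\<And>r a. \<lbrakk>r \<in> carrier R; a \<in> I\<rbrakk> \<Longrightarrow> r \<otimes> a \<in> I"
proof -
  interpret additive_subgroup I R using assms by (simp add: left_ideal_def)
  show "I \<subseteq> carrier R" "\<zero> \<in> I" "\<And>a b. \<lbrakk>a \<in> I; b \<in> I\<rbrakk> \<Longrightarrow> a \<oplus> b \<in> I"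
    by (simp_all add: a_subset)
  show "\<And>r a. \<lbrakk>r \<in> carrier R; a \<in> I\<rbrakk> \<Longrightarrow> r \<otimes> a \<in> I"
    using assms by (simp add: left_ideal_def)
qed

lemma principal_left_ideal:
  assumes s: "s \<in> carrier R"
  shows "left_ideal {x \<otimes> s | x. x \<in> carrier R} R"
proof (rule left_idealI)
  show "\<zero> \<in> {x \<otimes> s | x. x \<in> carrier R}" using s by (auto intro!: exI[of _ \<zero>])
  fix a b assume "a \<in> {x \<otimes> s | x. x \<in> carrier R}" "b \<in> {x \<otimes> s | x. x \<in> carrier R}"
  then obtain x y where "x \<in> carrier R" "a = x \<otimes> s" "y \<in> carrier R" "b = y \<otimes> s" by blast
  then show "a \<oplus> b \<in> {x \<otimes> s | x. x \<in> carrier R}"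
    using s by (auto intro!: exI[of _ "x \<oplus> y"] simp: l_distr)
next
  fix r a assume r: "r \<in> carrier R" and "a \<in> {x \<otimes> s | x. x \<in> carrier R}"
  then obtain x where "x \<in> carrier R" "a = x \<otimes> s" by blast
  then show "r \<otimes> a \<in> {x \<otimes> s | x. x \<in> carrier R}"
    using s r by (auto intro!: exI[of _ "r \<otimes> x"] simp: m_assoc)
qed (use s in auto)

end

context denominator_set
begin

text \<open>
  Such an \<open>s\<close> is one for which \<open>Rs\<close> is minimal among the left ideals generated by elements of \<open>S\<close>:
  \<open>Rts \<subseteq> Rs\<close> cannot be strict. If there were none, choosing at each stage a multiple \<open>ts\<close> with \<open>s \<notin> Rts\<close> would give an infinite descending chain.
\<close>

lemma artinian_absorbing_denominator:
  assumes art: "left_artinian R"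
  obtains s where "s \<in> S" "\<And>t. t \<in> S \<Longrightarrow> \<exists>y\<in>carrier R. y \<otimes> t \<otimes> s = s"
proof -
  have "\<exists>s\<in>S. \<forall>t\<in>S. \<exists>y\<in>carrier R. y \<otimes> t \<otimes> s = s"
  proof (rule ccontr)
    assume "\<not> ?thesis"
    then have "\<forall>s\<in>S. \<exists>t\<in>S. \<forall>y\<in>carrier R. y \<otimes> t \<otimes> s \<noteq> s" by blast
    then obtain g where g: "\<And>s. s \<in> S \<Longrightarrow> g s \<in> S"
      "\<And>s y. \<lbrakk>s \<in> S; y \<in> carrier R\<rbrakk> \<Longrightarrow> y \<otimes> g s \<otimes> s \<noteq> s" by metis
    define a where "a = rec_nat \<one> (\<lambda>_ s. g s \<otimes> s)"
    have a_Suc: "a (Suc n) = g (a n) \<otimes> a n" for n by (simp add: a_def)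
    have a_S: "a n \<in> S" for n
      by (induct n) (simp_all add: a_Suc g denominator_mult, simp add: a_def denominator_one)
    note a_carr = a_S[THEN denominator_carrier] g(1)[OF a_S, THEN denominator_carrier]
    let ?I = "\<lambda>n. {x \<otimes> a n | x. x \<in> carrier R}"
    have "?I (Suc n) \<subseteq> ?I n" for n
    proof
      fix z assume "z \<in> ?I (Suc n)"
      then obtain x where x: "x \<in> carrier R" "z = x \<otimes> a (Suc n)" by blast
      then have "z = (x \<otimes> g (a n)) \<otimes> a n" using a_carr by (simp add: a_Suc m_assoc)
      then show "z \<in> ?I n" using x a_carr by blast
    qed
    then have "\<forall>n. left_ideal (?I n) R \<and> ?I (Suc n) \<subseteq> ?I n"
      using principal_left_ideal[OF a_carr(1)] by blast
    then obtain N where N: "\<forall>n\<ge>N. ?I n = ?I N"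
      using art[unfolded left_artinian_def, THEN spec, of ?I] by blast
    have "a N \<in> ?I N" using a_carr[of N] by (auto intro!: exI[of _ \<one>])
    also have "?I N = ?I (Suc N)" using N le_Suc_eq by blast
    finally obtain y where "y \<in> carrier R" "a N = y \<otimes> a (Suc N)" by blast
    then show False using g(2)[OF a_S, of y N] a_carr[of N] by (simp add: a_Suc m_assoc)
  qed
  then show thesis using that by blast
qed

text \<open>
  From \<open>yts = s\<close> one gets \<open>(yt - 1)s = 0\<close>, so \<open>y\<close> is a left inverse of \<open>t\<close> modulo \<open>ass S\<close>. Since
  \<open>t\<close> is right cancellable modulo \<open>ass S\<close>, it is a right inverse as well.
\<close>

lemma artinian_inverting_quotient:
  assumes art: "left_artinian R"
  shows "inverting_quotient R S (R Quot ass R S) ((+>) (ass R S))"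
proof -
  interpret I: ideal "ass R S" R by (rule ass_ideal)
  have coset_eq: "ass R S +> r = ass R S +> q \<longleftrightarrow> r \<ominus> q \<in> ass R S"
    if "r \<in> carrier R" "q \<in> carrier R" for r q
    using quotient_eq_iff_same_a_r_cos[OF ass_ideal that] by simp
  have coset_carr: "(+>) (ass R S) ` carrier R = carrier (R Quot ass R S)"
    by (auto simp: FactRing_def A_RCOSETS_def')
  have coset_mult: "(ass R S +> r) \<otimes>\<^bsub>R Quot ass R S\<^esub> (ass R S +> q) = ass R S +> r \<otimes> q"
    if "r \<in> carrier R" "q \<in> carrier R" for r q
    using that by (simp add: FactRing_def I.rcoset_mult_add)
  show ?thesis
  proof (intro inverting_quotient.intro inverting_quotient_axioms.intro)
    show "denominator_set R S" "ring_hom_ring R (R Quot ass R S) ((+>) (ass R S))"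
      by (rule denominator_set_axioms I.rcos_ring_hom_ring)+
    show "(+>) (ass R S) ` carrier R = carrier (R Quot ass R S)" by (rule coset_carr)
    show "ass R S +> r = \<zero>\<^bsub>R Quot ass R S\<^esub> \<longleftrightarrow> r \<in> ass R S" if "r \<in> carrier R" for r
      using that I.a_rcos_const I.rcos_const_imp_mem by (auto simp: FactRing_def)
    show "ass R S +> t \<in> Units (R Quot ass R S)" if t: "t \<in> S" for t
    proof -
      have t': "t \<in> carrier R" using t by (rule denominator_carrier)
      obtain s where s: "s \<in> S" "\<And>t. t \<in> S \<Longrightarrow> \<exists>y\<in>carrier R. y \<otimes> t \<otimes> s = s"
        using artinian_absorbing_denominator[OF art] by blast
      then obtain y where y: "y \<in> carrier R" "y \<otimes> t \<otimes> s = s" using t by blast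
      have s': "s \<in> carrier R" using s(1) by (rule denominator_carrier)
      have "(y \<otimes> t \<ominus> \<one>) \<otimes> s = y \<otimes> t \<otimes> s \<ominus> s"
        using y(1) t' s' by (simp add: a_minus_def l_distr l_minus)
      then have left: "y \<otimes> t \<ominus> \<one> \<in> ass R S"
        using y t' s' s(1) by (intro reversible[of _ s]) auto
      have comm: "(t \<otimes> y \<ominus> \<one>) \<otimes> t = t \<otimes> (y \<otimes> t \<ominus> \<one>)"
        using y(1) t' by (simp add: a_minus_def l_distr r_distr l_minus r_minus m_assoc)
      have right: "t \<otimes> y \<ominus> \<one> \<in> ass R S"
        by (rule ass_cancel_right[OF t]) (use left t' y comm in \<open>simp_all add: I.I_l_closed\<close>)
      show ?thesis
        unfolding Units_def
      proof (intro CollectI conjI bexI)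
        show "ass R S +> t \<in> carrier (R Quot ass R S)" "ass R S +> y \<in> carrier (R Quot ass R S)"
          using t' y by (auto simp flip: coset_carr)
        show "(ass R S +> y) \<otimes>\<^bsub>R Quot ass R S\<^esub> (ass R S +> t) = \<one>\<^bsub>R Quot ass R S\<^esub>"
          "(ass R S +> t) \<otimes>\<^bsub>R Quot ass R S\<^esub> (ass R S +> y) = \<one>\<^bsub>R Quot ass R S\<^esub>"
          using left right t' y by (simp_all add: coset_mult coset_eq) (simp_all add: FactRing_def coset_eq)
      qed
    qed
  qed
qed

text \<open>
  The absorbing \<open>s\<close> annihilates \<open>ass S\<close> from the left: if \<open>tr = 0\<close>, the Ore condition \<open>cs = dt\<close> with
  \<open>s \<in> Rcs\<close> gives \<open>sr = 0\<close>. Hence \<open>ass S\<close> is the right annihilator of the single element \<open>s\<close>, and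
  it remains to replace \<open>s\<close> by the idempotent \<open>ys\<close>, where \<open>ys\<^sup>2 = s\<close>.
\<close>

lemma artinian_ass_eq_compl_ideal:
  assumes art: "left_artinian R"
  obtains e where "e \<in> I_l R" "ass R S = compl_ideal R e"
proof -
  interpret I: ideal "ass R S" R by (rule ass_ideal)
  obtain s where s: "s \<in> S" "\<And>t. t \<in> S \<Longrightarrow> \<exists>y\<in>carrier R. y \<otimes> t \<otimes> s = s"
    using artinian_absorbing_denominator[OF art] by blast
  have s': "s \<in> carrier R" using s(1) by (rule denominator_carrier)
  have kills: "s \<otimes> r = \<zero>" if r: "r \<in> ass R S" for r
  proof -
    obtain t where t: "r \<in> carrier R" "t \<in> S" "t \<otimes> r = \<zero>" using r by (rule assE)
    obtain c d where cd: "c \<in> S" "d \<in> carrier R" "c \<otimes> s = d \<otimes> t" using ore[OF s' t(2)] .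
    obtain y where y: "y \<in> carrier R" "y \<otimes> c \<otimes> s = s" using s(2)[OF cd(1)] by blast
    note carr = s' t(1) cd(2) y(1) cd(1)[THEN denominator_carrier] t(2)[THEN denominator_carrier]
    have "s \<otimes> r = y \<otimes> (c \<otimes> s) \<otimes> r" using y(2) carr by (simp add: m_assoc)
    also have "\<dots> = y \<otimes> (d \<otimes> (t \<otimes> r))" using carr by (simp add: cd(3) m_assoc)
    finally show ?thesis using carr t(3) by simp
  qed
  obtain y where y: "y \<in> carrier R" "y \<otimes> s \<otimes> s = s" using s(2)[OF s(1)] by blast
  have "(\<one> \<ominus> y \<otimes> s) \<otimes> s = s \<ominus> y \<otimes> s \<otimes> s"
    using y(1) s' by (simp add: a_minus_def l_distr l_minus)
  then have "\<one> \<ominus> y \<otimes> s \<in> ass R S"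
    using y s' s(1) by (intro reversible[of _ s]) auto
  then have "s \<otimes> (\<one> \<ominus> y \<otimes> s) = \<zero>" by (rule kills)
  then have sys: "s \<otimes> (y \<otimes> s) = s" using s' y by (simp add: mult_compl_eq_zero_iff)
  define e where "e = y \<otimes> s"
  have e: "e \<in> carrier R" "s \<otimes> e = s" using y s' sys by (simp_all add: e_def)
  have idem: "e \<otimes> e = e" using y s' sys by (simp add: e_def m_assoc)
  have ann: "r \<in> ass R S \<longleftrightarrow> e \<otimes> r = \<zero>" if r: "r \<in> carrier R" for r
  proof
    assume "r \<in> ass R S"
    then show "e \<otimes> r = \<zero>" using y s' r by (simp add: e_def m_assoc kills)
  next
    assume "e \<otimes> r = \<zero>"
    then have "s \<otimes> r = \<zero>" using r e s' m_assoc[of s e r] by simp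
    then show "r \<in> ass R S" using r e s(1) by (intro assI[of _ s]) auto
  qed
  have eq: "ass R S = compl_ideal R e"
    using ann by (auto simp: compl_ideal_eq_annihilator[OF e(1) idem] dest: I.Icarr)
  have nz: "\<one> \<noteq> \<zero>" using denominator_one denominator_nonzero by metis
  have "e \<noteq> \<zero>" using e s' s(1) denominator_nonzero by auto
  moreover have "e \<otimes> r \<otimes> e = e \<otimes> r" if r: "r \<in> carrier R" for r
  proof -
    have "r \<otimes> (\<one> \<ominus> e) \<in> ass R S"
      using compl_mem_compl_ideal[OF e(1)] r eq by (auto intro: I.I_l_closed)
    then have "e \<otimes> r \<otimes> (\<one> \<ominus> e) = \<zero>" using ann e r by (simp add: m_assoc)
    then show ?thesis using e r by (simp add: mult_compl_eq_zero_iff)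
  qed
  ultimately have "e \<in> I_l R" using e idem by (simp add: I_l_iff[OF nz])
  then show thesis using eq that by blast
qed

end

context ring
begin

lemma Den_l_denominator_set: "S \<in> Den_l R \<Longrightarrow> denominator_set R S"
  by unfold_locales (simp add: Den_l_def)

lemma artinian_localization:
  assumes art: "left_artinian R" and S: "S \<in> Den_l R"
  shows "inverting_quotient R S (localization R S) (loc_can R S)"
proof -
  interpret denominator_set R S using S by (rule Den_l_denominator_set)
  show ?thesis
    by (rule inverting_quotient.localization_inverting_quotient[OF artinian_inverting_quotient[OF art]])
qed

text \<open>
  Classes of localizations are sets of rings, so recovering \<open>S\<close> from the ring \<open>S\<inverse>R\<close> is needed to
  conclude from equality of two classes that their members are isomorphic.
\<close>

lemma localization_determines_denominators:
  assumes S: "S \<in> Den_l R"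
  shows "S = fst ` \<Union>(carrier (localization R S))"
proof -
  interpret denominator_set R S using S by (rule Den_l_denominator_set)
  show ?thesis
  proof (intro equalityI subsetI)
    fix s assume s: "s \<in> S"
    then have "(s, \<one>) \<in> lfrac R S s \<one>"
      using denominator_carrier unfolding lfrac_def by (auto intro!: bexI[of _ \<one>])
    moreover have "lfrac R S s \<one> \<in> carrier (localization R S)"
      using s by (auto simp: localization_def)
    ultimately have "(s, \<one>) \<in> \<Union>(carrier (localization R S))" by (rule UnionI[rotated])
    then show "s \<in> fst ` \<Union>(carrier (localization R S))" by (rule rev_image_eqI) simp
  next
    fix s assume "s \<in> fst ` \<Union>(carrier (localization R S))"
    then obtain q t r where "(s, q) \<in> lfrac R S t r" by (auto simp: localization_def)
    then show "s \<in> S" by (simp add: lfrac_def)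
  qed
qed

lemma loc_class_eq_iff:
  assumes art: "left_artinian R" and S: "S \<in> Den_l R" and T: "T \<in> Den_l R"
  shows "loc_class R S = loc_class R T \<longleftrightarrow> ass R S = ass R T"
proof -
  have loc_class: "loc_class R S' = {localization R T' | T'. T' \<in> Den_l R \<and> ass R S' = ass R T'}"
    if "S' \<in> Den_l R" for S'
    using that R_isomorphic_iff[OF artinian_localization[OF art that] artinian_localization[OF art]]
    unfolding loc_class_def by blast
  show ?thesis
  proof
    assume eq: "loc_class R S = loc_class R T"
    have "localization R T \<in> loc_class R T" using loc_class[OF T] T by blast
    then obtain T' where T': "T' \<in> Den_l R" "ass R S = ass R T'"
      "localization R T = localization R T'"
      using loc_class[OF S] eq by blast
    then have "T' = T" using localization_determines_denominators T by metis
    then show "ass R S = ass R T" using T' by simp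
  next
    assume "ass R S = ass R T"
    then show "loc_class R S = loc_class R T" by (simp add: loc_class S T)
  qed
qed

end

section \<open>The Jacobson radical\<close>

context ring
begin

text \<open>
  By maximality \<open>M + Rz = R\<close>; the left ideal \<open>M + Rz\<close> appears in the proof as the set of all \<open>y\<close>
  congruent to a multiple of \<open>z\<close> modulo \<open>M\<close>.
\<close>

lemma maximal_left_ideal_supplement:
  assumes M: "maximal_left_ideal M R" and z: "z \<in> carrier R" "z \<notin> M" and x: "x \<in> carrier R"
  obtains a where "a \<in> carrier R" "x \<ominus> a \<otimes> z \<in> M"
proof -
  have lM: "left_ideal M R" using M by (simp add: maximal_left_ideal_def)
  note M' = left_idealD[OF lM]
  let ?J = "{y \<in> carrier R. \<exists>a\<in>carrier R. y \<ominus> a \<otimes> z \<in> M}"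
  have "left_ideal ?J R"
  proof (rule left_idealI)
    show "\<zero> \<in> ?J" using M'(2) z by (auto intro!: bexI[of _ \<zero>] simp: a_minus_def)
    fix y y' assume "y \<in> ?J" "y' \<in> ?J"
    then obtain a a' where *: "y \<in> carrier R" "a \<in> carrier R" "y \<ominus> a \<otimes> z \<in> M"
      "y' \<in> carrier R" "a' \<in> carrier R" "y' \<ominus> a' \<otimes> z \<in> M" by blast
    have "(y \<oplus> y') \<ominus> (a \<oplus> a') \<otimes> z = (y \<ominus> a \<otimes> z) \<oplus> (y' \<ominus> a' \<otimes> z)"
      using *(1,2,4,5) z(1) by (simp add: a_minus_def l_distr minus_add a_ac)
    then show "y \<oplus> y' \<in> ?J" using * M'(3) by (auto intro!: bexI[of _ "a \<oplus> a'"])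
  next
    fix r y assume r: "r \<in> carrier R" and "y \<in> ?J"
    then obtain a where *: "y \<in> carrier R" "a \<in> carrier R" "y \<ominus> a \<otimes> z \<in> M" by blast
    have "r \<otimes> y \<ominus> (r \<otimes> a) \<otimes> z = r \<otimes> (y \<ominus> a \<otimes> z)"
      using *(1,2) r z(1) by (simp add: a_minus_def r_distr r_minus m_assoc)
    then show "r \<otimes> y \<in> ?J" using * r M'(4) by (auto intro!: bexI[of _ "r \<otimes> a"])
  qed auto
  moreover have "M \<subseteq> ?J"
  proof
    fix y assume "y \<in> M"
    then show "y \<in> ?J" using M'(1) z by (auto intro!: bexI[of _ \<zero>] simp: a_minus_def)
  qed
  moreover have "z \<in> ?J"
    using z M'(2) by (auto intro!: bexI[of _ \<one>] simp: a_minus_def r_neg)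
  ultimately have "?J = carrier R" using M z(2) unfolding maximal_left_ideal_def by blast
  then show thesis using x that by blast
qed

text \<open>
  As an intersection of left ideals the radical is obviously a left ideal. For the other side, note that
  for \<open>r \<notin> M\<close> the left ideal \<open>{y. yr \<in> M}\<close> is again maximal, being the kernel of the
  module homomorphism \<open>y \<mapsto> yr + M\<close> from \<open>R\<close> onto the simple module \<open>R/M\<close>; so it contains the radical.
\<close>

lemma jacobson_rad_right_mult:
  assumes x: "x \<in> jacobson_rad R" and r: "r \<in> carrier R"
  shows "x \<otimes> r \<in> jacobson_rad R"
proof -
  have x': "x \<in> carrier R" using x by (simp add: jacobson_rad_def)
  have "x \<otimes> r \<in> M" if M: "maximal_left_ideal M R" for M
  proof (cases "r \<in> M")
    case True
    then show ?thesis using M x' left_idealD(4)[of M] by (simp add: maximal_left_ideal_def)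
  next
    case False
    have lM: "left_ideal M R" using M by (simp add: maximal_left_ideal_def)
    note M' = left_idealD[OF lM]
    let ?K = "{y \<in> carrier R. y \<otimes> r \<in> M}"
    have K: "left_ideal ?K R"
      by (rule left_idealI) (use M' r in \<open>auto simp: l_distr m_assoc\<close>)
    have "maximal_left_ideal ?K R"
      unfolding maximal_left_ideal_def
    proof (intro conjI allI impI)
      have "\<one> \<notin> ?K" using False r by simp
      then show "?K \<noteq> carrier R" by (metis one_closed)
      fix J assume J: "left_ideal J R \<and> ?K \<subseteq> J"
      note J' = left_idealD[OF conjunct1[OF J]]
      show "J = ?K \<or> J = carrier R"
      proof (rule disjCI)
        assume "J \<noteq> carrier R"
        then obtain z where z: "z \<in> carrier R" "z \<notin> J" using J' by blast
        have "y \<in> ?K" if y: "y \<in> J" for y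
        proof (rule ccontr)
          assume "y \<notin> ?K"
          then have y': "y \<in> carrier R" "y \<otimes> r \<notin> M" using y J'(1) by auto
          obtain a where a: "a \<in> carrier R" "z \<otimes> r \<ominus> a \<otimes> (y \<otimes> r) \<in> M"
            using maximal_left_ideal_supplement[OF M _ y'(2), of "z \<otimes> r"] y' z r by auto
          have "(z \<ominus> a \<otimes> y) \<otimes> r = z \<otimes> r \<ominus> a \<otimes> (y \<otimes> r)"
            using a(1) y'(1) z(1) r by (simp add: a_minus_def l_distr l_minus m_assoc)
          then have "z \<ominus> a \<otimes> y \<in> J" using a y' z r J by auto
          then have "(z \<ominus> a \<otimes> y) \<oplus> a \<otimes> y \<in> J" using J'(3,4) a y by blast
          moreover have "(z \<ominus> a \<otimes> y) \<oplus> a \<otimes> y = z"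
            using z(1) a(1) y'(1) by (simp add: a_minus_def a_assoc l_neg)
          ultimately show False using z by simp
        qed
        then show "J = ?K" using J by blast
      qed
    qed (rule K)
    then have "x \<in> ?K" using x unfolding jacobson_rad_def by blast
    then show ?thesis by simp
  qed
  then show ?thesis using x' r by (simp add: jacobson_rad_def)
qed

lemma jacobson_rad_ideal: "ideal (jacobson_rad R) R"
proof -
  have "left_ideal (jacobson_rad R) R"
    by (rule left_idealI)
      (auto simp: jacobson_rad_def maximal_left_ideal_def intro: left_idealD(2,3,4))
  then show ?thesis
    using jacobson_rad_right_mult
    by (auto intro!: ideal.intro ideal_axioms.intro ring_axioms simp: left_ideal_def)
qed

text \<open>
  Zorn's lemma, applied to the left ideals above \<open>L\<close> that do not contain \<open>1\<close>.
\<close>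

lemma exists_maximal_left_ideal:
  assumes L: "left_ideal L R" "\<one> \<notin> L"
  obtains M where "maximal_left_ideal M R" "L \<subseteq> M"
proof -
  let ?A = "{J. left_ideal J R \<and> L \<subseteq> J \<and> \<one> \<notin> J}"
  have "\<exists>M\<in>?A. \<forall>J\<in>?A. M \<subseteq> J \<longrightarrow> J = M"
  proof (rule subset_Zorn_nonempty)
    show "?A \<noteq> {}" using L by blast
    fix \<C> assume ne: "\<C> \<noteq> {}" and "subset.chain ?A \<C>"
    then have ch: "\<C> \<subseteq> ?A" "\<And>J K. \<lbrakk>J \<in> \<C>; K \<in> \<C>\<rbrakk> \<Longrightarrow> J \<subseteq> K \<or> K \<subseteq> J"
      by (auto simp: subset_chain_def)
    have "left_ideal (\<Union>\<C>) R"
    proof (rule left_idealI)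
      show "\<Union>\<C> \<subseteq> carrier R" using ch(1) left_idealD(1) by blast
      show "\<zero> \<in> \<Union>\<C>" using ch(1) ne left_idealD(2) by blast
      show "a \<oplus> b \<in> \<Union>\<C>" if ab: "a \<in> \<Union>\<C>" "b \<in> \<Union>\<C>" for a b
      proof -
        obtain J K where JK: "J \<in> \<C>" "a \<in> J" "K \<in> \<C>" "b \<in> K" using ab by blast
        then obtain H where "H \<in> \<C>" "a \<in> H" "b \<in> H" using ch(2)[of J K] by blast
        then show ?thesis using ch(1) left_idealD(3)[of H a b] by blast
      qed
      show "r \<otimes> a \<in> \<Union>\<C>" if "r \<in> carrier R" "a \<in> \<Union>\<C>" for r a
        using that ch(1) left_idealD(4) by blast
    qed
    then show "\<Union>\<C> \<in> ?A" using ch(1) ne by blast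
  qed
  then obtain M where "M \<in> ?A" and max: "\<forall>J\<in>?A. M \<subseteq> J \<longrightarrow> J = M" by (rule bexE)
  then have M: "left_ideal M R" "L \<subseteq> M" "\<one> \<notin> M" by simp_all
  have "maximal_left_ideal M R"
    unfolding maximal_left_ideal_def
  proof (intro conjI allI impI)
    show "M \<noteq> carrier R" using M(3) by auto
    fix J assume J: "left_ideal J R \<and> M \<subseteq> J"
    show "J = M \<or> J = carrier R"
    proof (cases "\<one> \<in> J")
      case True
      have "r \<in> J" if "r \<in> carrier R" for r
        using left_idealD(4)[OF conjunct1[OF J] that True] that by simp
      then show ?thesis using left_idealD(1)[OF conjunct1[OF J]] by blast
    next
      case False
      then have "J \<in> ?A" using J M by auto
      then show ?thesis using J max by simp
    qed
  qed (rule M)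
  then show thesis using M that by blast
qed

text \<open>
  If \<open>g \<noteq> 0\<close>, then \<open>R(1 - g)\<close> is a proper left ideal, because it is annihilated by \<open>g\<close> from the right.
  A maximal left ideal above it would contain both \<open>1 - g\<close> and \<open>g\<close>.
\<close>

lemma jacobson_rad_idempotent_zero:
  assumes g: "g \<in> jacobson_rad R" "g \<otimes> g = g"
  shows "g = \<zero>"
proof (rule ccontr)
  assume nz: "g \<noteq> \<zero>"
  have g': "g \<in> carrier R" using g by (simp add: jacobson_rad_def)
  let ?L = "{x \<otimes> (\<one> \<ominus> g) | x. x \<in> carrier R}"
  have L: "left_ideal ?L R" using g' by (intro principal_left_ideal) simp
  have zero: "(\<one> \<ominus> g) \<otimes> g = \<zero>"
    using g' g(2) by (simp add: a_minus_def l_distr l_minus r_neg)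
  have "\<one> \<notin> ?L"
  proof
    assume "\<one> \<in> ?L"
    then obtain x where x: "x \<in> carrier R" "\<one> = x \<otimes> (\<one> \<ominus> g)" by blast
    have "g = x \<otimes> (\<one> \<ominus> g) \<otimes> g" using g' by (simp flip: x(2))
    also have "\<dots> = \<zero>" using x(1) g' zero by (simp add: m_assoc)
    finally show False using nz by simp
  qed
  then obtain M where M: "maximal_left_ideal M R" "?L \<subseteq> M"
    using exists_maximal_left_ideal[OF L] by blast
  have lM: "left_ideal M R" "M \<noteq> carrier R" using M(1) by (simp_all add: maximal_left_ideal_def)
  have "\<one> \<ominus> g \<in> ?L" using g' by (auto intro!: exI[of _ \<one>])
  moreover have "g \<in> M" using g M(1) by (simp add: jacobson_rad_def)
  ultimately have "(\<one> \<ominus> g) \<oplus> g \<in> M" using M(2) left_idealD(3)[OF lM(1)] by blast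
  then have "\<one> \<in> M" using g' by (simp add: a_minus_def a_assoc l_neg)
  then have "carrier R \<subseteq> M" using left_idealD(4)[OF lM(1), of _ \<one>] by (metis r_one subsetI)
  then show False using lM left_idealD(1)[OF lM(1)] by blast
qed

end

section \<open>Central idempotents modulo the radical and their lifts\<close>

text \<open>
  The elements \<open>x\<close> with \<open>bBx = 0\<close> form a two-sided ideal that contains \<open>1 - b\<close>. If it is zero, then
  \<open>b = 1\<close>; if it contains \<open>1\<close>, then \<open>b = 0\<close>.
\<close>

lemma simple_ring_corner_idempotent:
  assumes simple: "simple_artinian B" and b: "b \<in> carrier B"
    and corner: "\<And>y. y \<in> carrier B \<Longrightarrow> b \<otimes>\<^bsub>B\<^esub> y \<otimes>\<^bsub>B\<^esub> b = b \<otimes>\<^bsub>B\<^esub> y"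
  shows "b = \<zero>\<^bsub>B\<^esub> \<or> b = \<one>\<^bsub>B\<^esub>"
proof -
  interpret B: ring B using simple by (simp add: simple_artinian_def)
  let ?I = "{x \<in> carrier B. \<forall>y\<in>carrier B. b \<otimes>\<^bsub>B\<^esub> y \<otimes>\<^bsub>B\<^esub> x = \<zero>\<^bsub>B\<^esub>}"
  have "ideal ?I B"
  proof (rule idealI)
    show "subgroup ?I (add_monoid B)"
      by (rule B.add.subgroupI) (use b in \<open>auto simp: B.r_minus B.r_distr\<close>)
    show "x \<otimes>\<^bsub>B\<^esub> a \<in> ?I" if "a \<in> ?I" "x \<in> carrier B" for a x
    proof -
      have "b \<otimes>\<^bsub>B\<^esub> y \<otimes>\<^bsub>B\<^esub> (x \<otimes>\<^bsub>B\<^esub> a) = b \<otimes>\<^bsub>B\<^esub> (y \<otimes>\<^bsub>B\<^esub> x) \<otimes>\<^bsub>B\<^esub> a" if "y \<in> carrier B" for y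
        using that \<open>a \<in> ?I\<close> \<open>x \<in> carrier B\<close> b by (simp add: B.m_assoc)
      then show ?thesis using that by auto
    qed
    show "a \<otimes>\<^bsub>B\<^esub> x \<in> ?I" if "a \<in> ?I" "x \<in> carrier B" for a x
      using that b by (auto simp flip: B.m_assoc)
  qed (rule B.ring_axioms)
  then have "?I = {\<zero>\<^bsub>B\<^esub>} \<or> ?I = carrier B" using simple by (simp add: simple_artinian_def)
  then show ?thesis
  proof
    assume I: "?I = {\<zero>\<^bsub>B\<^esub>}"
    have "\<one>\<^bsub>B\<^esub> \<ominus>\<^bsub>B\<^esub> b \<in> ?I" using b corner by (simp add: B.mult_compl_eq_zero_iff)
    then have "\<one>\<^bsub>B\<^esub> \<ominus>\<^bsub>B\<^esub> b = \<zero>\<^bsub>B\<^esub>" using I by blast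
    then show ?thesis using b by auto
  next
    assume "?I = carrier B"
    then have "\<one>\<^bsub>B\<^esub> \<in> ?I" by simp
    then have "b \<otimes>\<^bsub>B\<^esub> \<one>\<^bsub>B\<^esub> \<otimes>\<^bsub>B\<^esub> \<one>\<^bsub>B\<^esub> = \<zero>\<^bsub>B\<^esub>" by blast
    then show ?thesis using b by simp
  qed
qed

lemma nth_RDirProd_list_hom:
  "i < length Bs \<Longrightarrow> (\<lambda>as. as ! i) \<in> ring_hom (RDirProd_list Bs) (Bs ! i)"
proof (induct Bs arbitrary: i)
  case Nil
  then show ?case by simp
next
  case (Cons B Bs)
  let ?P = "RDirProd_list (B # Bs)" and ?Q = "RDirProd_list Bs"
  note cons = ring_hom_memE[OF RDirProd_list_hom1[of B Bs]]
  have carr: "\<exists>a as. a \<in> carrier B \<and> as \<in> carrier ?Q \<and> x = a # as" if "x \<in> carrier ?P" for x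
    using that by (auto simp: RDirProd_list_carrier)
  have mult: "(a # as) \<otimes>\<^bsub>?P\<^esub> (b # bs) = (a \<otimes>\<^bsub>B\<^esub> b) # (as \<otimes>\<^bsub>?Q\<^esub> bs)"
    and add: "(a # as) \<oplus>\<^bsub>?P\<^esub> (b # bs) = (a \<oplus>\<^bsub>B\<^esub> b) # (as \<oplus>\<^bsub>?Q\<^esub> bs)"
    if "a \<in> carrier B" "b \<in> carrier B" "as \<in> carrier ?Q" "bs \<in> carrier ?Q" for a b as bs
    using cons(2,3)[of "(a, as)" "(b, bs)"] that
    by (simp_all add: RDirProd_def DirProd_def monoid.defs)
  have one: "\<one>\<^bsub>?P\<^esub> = \<one>\<^bsub>B\<^esub> # \<one>\<^bsub>?Q\<^esub>" by (simp add: RDirProd_list_one)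
  show ?case
  proof (cases i)
    case 0
    show ?thesis
    proof (rule ring_hom_memI)
      fix x y assume "x \<in> carrier ?P" "y \<in> carrier ?P"
      then show "(x \<otimes>\<^bsub>?P\<^esub> y) ! i = x ! i \<otimes>\<^bsub>(B # Bs) ! i\<^esub> y ! i"
        "(x \<oplus>\<^bsub>?P\<^esub> y) ! i = x ! i \<oplus>\<^bsub>(B # Bs) ! i\<^esub> y ! i"
        using carr[of x] carr[of y] 0 by (auto simp: mult add)
    next
      fix x assume "x \<in> carrier ?P"
      then show "x ! i \<in> carrier ((B # Bs) ! i)" using carr[of x] 0 by auto
    qed (simp add: one 0)
  next
    case (Suc k)
    then have "k < length Bs" using Cons.prems by simp
    note IH = ring_hom_memE[OF Cons.hyps[OF this]]
    show ?thesis
    proof (rule ring_hom_memI)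
      fix x y assume "x \<in> carrier ?P" "y \<in> carrier ?P"
      then show "(x \<otimes>\<^bsub>?P\<^esub> y) ! i = x ! i \<otimes>\<^bsub>(B # Bs) ! i\<^esub> y ! i"
        "(x \<oplus>\<^bsub>?P\<^esub> y) ! i = x ! i \<oplus>\<^bsub>(B # Bs) ! i\<^esub> y ! i"
        using carr[of x] carr[of y] Suc by (auto simp: mult add IH)
    next
      fix x assume "x \<in> carrier ?P"
      then show "x ! i \<in> carrier ((B # Bs) ! i)" using carr[of x] Suc by (auto simp: IH)
    qed (simp add: one Suc IH)
  qed
qed

text \<open>
  The setting: \<open>R/rad R\<close> is a finite product of simple rings \<open>B\<^sub>i\<close>, whose identities are lifted to
  orthogonal idempotents of \<open>R\<close>. The isomorphism \<open>\<phi>\<close> is used only through the homomorphisms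
  \<open>R \<rightarrow> B\<^sub>i\<close>, which are surjective and whose common kernel lies in the radical.
\<close>

locale lifted_central_idempotents = ring R for R :: "('a, 'm) ring_scheme" (structure) +
  fixes Bs :: "('b, 'n) ring_scheme list" and \<phi> and u :: "nat \<Rightarrow> 'a" and s
  assumes len: "length Bs = s"
    and simple: "i < s \<Longrightarrow> simple_artinian (Bs ! i)"
    and iso: "\<phi> \<in> ring_iso (R Quot jacobson_rad R) (RDirProd_list Bs)"
    and u_closed: "i < s \<Longrightarrow> u i \<in> carrier R"
    and u_idem: "i < s \<Longrightarrow> u i \<otimes> u i = u i"
    and u_orth: "\<lbrakk>i < s; j < s; i \<noteq> j\<rbrakk> \<Longrightarrow> u i \<otimes> u j = \<zero>"
    and u_lift: "i < s \<Longrightarrow> \<phi> (jacobson_rad R +> u i) = factor_one Bs i"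
begin

definition component :: "nat \<Rightarrow> 'a \<Rightarrow> 'b" where
  "component i r = \<phi> (jacobson_rad R +> r) ! i"

lemma simple_ring: "i < s \<Longrightarrow> ring (Bs ! i)"
  using simple by (simp add: simple_artinian_def)

lemma component_hom: "i < s \<Longrightarrow> component i \<in> ring_hom R (Bs ! i)"
proof -
  assume i: "i < s"
  have "\<phi> \<circ> (+>) (jacobson_rad R) \<in> ring_hom R (RDirProd_list Bs)"
    using iso by (intro ring_hom_trans[OF ideal.rcos_ring_hom[OF jacobson_rad_ideal]])
      (simp add: ring_iso_def)
  then have "(\<lambda>as. as ! i) \<circ> (\<phi> \<circ> (+>) (jacobson_rad R)) \<in> ring_hom R (Bs ! i)"
    using i len by (intro ring_hom_trans[OF _ nth_RDirProd_list_hom]) simp_all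
  then show ?thesis by (simp add: component_def[abs_def] comp_def)
qed

lemma component_ring_hom_ring: "i < s \<Longrightarrow> ring_hom_ring R (Bs ! i) (component i)"
  by (intro ring_hom_ringI2 ring_axioms simple_ring component_hom)

lemma component_surj:
  assumes i: "i < s"
  shows "component i ` carrier R = carrier (Bs ! i)"
proof (intro equalityI subsetI)
  fix b assume b: "b \<in> carrier (Bs ! i)"
  define bs where "bs = map (\<lambda>j. if j = i then b else \<zero>\<^bsub>Bs ! j\<^esub>) [0..<s]"
  have "bs \<in> carrier (RDirProd_list Bs)"
    using b len simple_ring
    by (intro RDirProd_list_carrier_memI) (auto simp: bs_def intro: ring.ring_simprules)
  then have "bs \<in> \<phi> ` carrier (R Quot jacobson_rad R)"
    using ring_iso_memE(5)[OF iso] by (simp add: bij_betw_def)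
  then obtain r where "r \<in> carrier R" "bs = \<phi> (jacobson_rad R +> r)"
    by (auto simp: FactRing_def A_RCOSETS_def')
  moreover have "bs ! i = b" using i by (simp add: bs_def)
  ultimately show "b \<in> component i ` carrier R" by (auto simp: component_def)
qed (use ring_hom_closed[OF component_hom[OF i]] in auto)

lemma component_kernel:
  assumes r: "r \<in> carrier R" and zero: "\<And>i. i < s \<Longrightarrow> component i r = \<zero>\<^bsub>Bs ! i\<^esub>"
  shows "r \<in> jacobson_rad R"
proof -
  interpret J: ideal "jacobson_rad R" R by (rule jacobson_rad_ideal)
  have carr: "jacobson_rad R +> x \<in> carrier (R Quot jacobson_rad R)" if "x \<in> carrier R" for x
    using that by (auto simp: FactRing_def A_RCOSETS_def')
  have len': "length (\<phi> (jacobson_rad R +> x)) = s" if "x \<in> carrier R" for x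
    using RDirProd_list_carrier_mem(1)[OF ring_iso_memE(1)[OF iso carr[OF that]]] len by simp
  have "component i r = component i \<zero>" if "i < s" for i
    using zero[OF that] ring_hom_zero[OF component_hom[OF that] ring_axioms simple_ring[OF that]]
    by simp
  then have "\<phi> (jacobson_rad R +> r) = \<phi> (jacobson_rad R +> \<zero>)"
    using r by (intro nth_equalityI) (simp_all add: len' component_def)
  then have "jacobson_rad R +> r = jacobson_rad R +> \<zero>"
    using bij_betw_imp_inj_on[OF ring_iso_memE(5)[OF iso]] carr r by (simp add: inj_on_eq_iff)
  then show ?thesis using r J.rcos_const_imp_mem by (simp add: J.a_subset)
qed

lemma component_u: "i < s \<Longrightarrow> component i (u i) = \<one>\<^bsub>Bs ! i\<^esub>"
  by (simp add: component_def u_lift factor_one_def len)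

lemma e_sum_empty: "e_sum R u {} = \<zero>"
  by (simp add: e_sum_def)

lemma e_sum_insert:
  "\<lbrakk>i < s; I \<subseteq> {..<s}; i \<notin> I\<rbrakk> \<Longrightarrow> e_sum R u (insert i I) = u i \<oplus> e_sum R u I"
  unfolding e_sum_def using finite_subset[of I "{..<s}"] u_closed
  by (intro finsum_insert) auto

lemma e_sum_closed: "I \<subseteq> {..<s} \<Longrightarrow> e_sum R u I \<in> carrier R"
  unfolding e_sum_def using u_closed by (intro finsum_closed) auto

lemma u_mult_e_sum:
  assumes i: "i < s" and J: "J \<subseteq> {..<s}"
  shows "u i \<otimes> e_sum R u J = (if i \<in> J then u i else \<zero>)"
proof -
  have "finite J" using J finite_subset by blast
  then show ?thesis using J
  proof (induct J)
    case empty
    then show ?case using i by (simp add: e_sum_empty u_closed)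
  next
    case (insert j J)
    have "u i \<otimes> u j = (if i = j then u i else \<zero>)" using i insert by (simp add: u_idem u_orth)
    then show ?case
      using i insert by (auto simp: e_sum_insert e_sum_closed u_closed r_distr)
  qed
qed

lemma e_sum_mult:
  assumes I: "I \<subseteq> {..<s}" and J: "J \<subseteq> {..<s}"
  shows "e_sum R u I \<otimes> e_sum R u J = e_sum R u (I \<inter> J)"
proof -
  have "finite I" using I finite_subset by blast
  then show ?thesis using I
  proof (induct I)
    case empty
    then show ?case using J by (simp add: e_sum_empty e_sum_closed)
  next
    case (insert i I)
    have carr: "e_sum R u I \<in> carrier R" "e_sum R u J \<in> carrier R" "e_sum R u (I \<inter> J) \<in> carrier R"
      using insert J by (auto intro: e_sum_closed)
    have "e_sum R u (insert i I) \<otimes> e_sum R u J = (if i \<in> J then u i else \<zero>) \<oplus> e_sum R u (I \<inter> J)"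
      using insert J carr by (simp add: e_sum_insert u_closed l_distr u_mult_e_sum)
    also have "\<dots> = e_sum R u (insert i I \<inter> J)"
      using insert carr e_sum_insert[of i "I \<inter> J"] by (auto simp: subset_iff)
    finally show ?case .
  qed
qed

lemma e_sum_singleton: "i < s \<Longrightarrow> e_sum R u {i} = u i"
  using e_sum_insert[of i "{}"] by (simp add: e_sum_empty u_closed)

text \<open>
  Read off from \<open>e_I u\<^sub>i = e_{I \<inter> {i}}\<close>, since \<open>u\<^sub>i\<close> has image \<open>1\<close> in \<open>B\<^sub>i\<close>.
\<close>

lemma component_e_sum:
  assumes i: "i < s" and I: "I \<subseteq> {..<s}"
  shows "component i (e_sum R u I) = (if i \<in> I then \<one>\<^bsub>Bs ! i\<^esub> else \<zero>\<^bsub>Bs ! i\<^esub>)"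
proof -
  interpret h: ring_hom_ring R "Bs ! i" "component i" using i by (rule component_ring_hom_ring)
  have "component i (e_sum R u I) = component i (e_sum R u I \<otimes> u i)"
    using i I by (simp add: component_u e_sum_closed u_closed)
  also have "e_sum R u I \<otimes> u i = e_sum R u (I \<inter> {i})"
    using e_sum_mult[OF I, of "{i}"] i by (simp add: e_sum_singleton)
  also have "component i (e_sum R u (I \<inter> {i})) = (if i \<in> I then \<one>\<^bsub>Bs ! i\<^esub> else \<zero>\<^bsub>Bs ! i\<^esub>)"
    using i by (simp add: e_sum_singleton e_sum_empty component_u)
  finally show ?thesis .
qed

lemma e_sum_nonzero:
  assumes I: "I \<subseteq> {..<s}" "I \<noteq> {}"
  shows "e_sum R u I \<noteq> \<zero>"
proof -
  obtain i where i: "i \<in> I" "i < s" using I by blast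
  interpret h: ring_hom_ring R "Bs ! i" "component i" using i by (intro component_ring_hom_ring)
  have "component i (e_sum R u I) \<noteq> component i \<zero>"
    using i simple[OF i(2)] by (simp add: component_e_sum[OF i(2) I(1)] simple_artinian_def)
  then show ?thesis by metis
qed

lemma I_l'_iff:
  "e \<in> I_l' R s u \<longleftrightarrow> (\<exists>I. I \<noteq> {} \<and> I \<subseteq> {..<s} \<and> e = e_sum R u I \<and>
      (\<forall>r\<in>carrier R. e \<otimes> r \<otimes> e = e \<otimes> r))"
  by (auto simp: I_l'_def mult_compl_eq_zero_iff e_sum_closed)

lemma I_l'_subset_I_l:
  assumes "\<one> \<noteq> \<zero>"
  shows "I_l' R s u \<subseteq> I_l R"
proof
  fix e assume "e \<in> I_l' R s u"
  then obtain I where I: "I \<noteq> {}" "I \<subseteq> {..<s}" "e = e_sum R u I"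
    and corner: "\<forall>r\<in>carrier R. e \<otimes> r \<otimes> e = e \<otimes> r" unfolding I_l'_iff by blast
  have "e \<otimes> e = e" using e_sum_mult[OF I(2) I(2)] by (simp add: I)
  then show "e \<in> I_l R"
    using I corner by (simp add: I_l_iff[OF assms] e_sum_closed e_sum_nonzero)
qed

lemma finite_I_l': "finite (I_l' R s u)"
proof (rule finite_subset)
  show "I_l' R s u \<subseteq> e_sum R u ` Pow {..<s}" by (auto simp: I_l'_def)
qed simp

lemma I_l'_commute: "\<lbrakk>e \<in> I_l' R s u; f \<in> I_l' R s u\<rbrakk> \<Longrightarrow> e \<otimes> f = f \<otimes> e"
  by (auto simp: I_l'_iff e_sum_mult Int_commute)

text \<open>
  Equality of kernels gives \<open>ef = e\<close> and \<open>fe = f\<close>, and the sums \<open>e_I\<close> commute.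
\<close>

lemma compl_ideal_inj_on_I_l':
  assumes nz: "\<one> \<noteq> \<zero>" and e: "e \<in> I_l' R s u" and f: "f \<in> I_l' R s u"
    and eq: "compl_ideal R e = compl_ideal R f"
  shows "e = f"
proof -
  have "e \<in> I_l R" "f \<in> I_l R" using I_l'_subset_I_l[OF nz] e f by auto
  then have "idem_ge R e f" "idem_ge R f e"
    using eq by (simp_all add: I_l_iff[OF nz] flip: compl_ideal_subset_iff)
  then show ?thesis using I_l'_commute[OF e f] by (simp add: idem_ge_def)
qed

text \<open>
  The corner condition passes from \<open>R\<close> to the simple factor because the projection is surjective.
\<close>

lemma I_l_component:
  assumes nz: "\<one> \<noteq> \<zero>" and e: "e \<in> I_l R" and i: "i < s"
  shows "component i e = \<zero>\<^bsub>Bs ! i\<^esub> \<or> component i e = \<one>\<^bsub>Bs ! i\<^esub>"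
proof (rule simple_ring_corner_idempotent[OF simple[OF i]])
  interpret h: ring_hom_ring R "Bs ! i" "component i" using i by (rule component_ring_hom_ring)
  have e': "e \<in> carrier R" "\<forall>r\<in>carrier R. e \<otimes> r \<otimes> e = e \<otimes> r"
    using e by (simp_all add: I_l_iff[OF nz])
  show "component i e \<in> carrier (Bs ! i)" using e' by simp
  fix y assume "y \<in> carrier (Bs ! i)"
  then obtain r where r: "r \<in> carrier R" "y = component i r" using component_surj[OF i] by blast
  have "component i (e \<otimes> r \<otimes> e) = component i (e \<otimes> r)" using e' r by simp
  then show "component i e \<otimes>\<^bsub>Bs ! i\<^esub> y \<otimes>\<^bsub>Bs ! i\<^esub> component i e = component i e \<otimes>\<^bsub>Bs ! i\<^esub> y"
    using e'(1) r by simp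
qed

text \<open>
  Let \<open>I\<close> collect the factors in which \<open>e\<close> has image \<open>1\<close>; then \<open>e - e_I\<close> lies in the radical. Write
  \<open>f = e_I\<close>, \<open>x = 1 - f\<close> and \<open>y = 1 - e\<close>. The corner condition gives \<open>exe = ex\<close> and \<open>yfy = fy\<close>, so \<open>ex\<close>
  and \<open>fy\<close> are idempotents; both lie in the radical and therefore vanish.
\<close>

lemma I_l_equivalent_I_l':
  assumes nz: "\<one> \<noteq> \<zero>" and e: "e \<in> I_l R"
  obtains f where "f \<in> I_l' R s u" "compl_ideal R e = compl_ideal R f"
proof -
  interpret J: ideal "jacobson_rad R" R by (rule jacobson_rad_ideal)
  have e': "e \<in> carrier R" "e \<otimes> e = e" "e \<noteq> \<zero>" and corner: "\<forall>r\<in>carrier R. e \<otimes> r \<otimes> e = e \<otimes> r"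
    using e by (simp_all add: I_l_iff[OF nz])
  define I where "I = {i. i < s \<and> component i e = \<one>\<^bsub>Bs ! i\<^esub>}"
  have I: "I \<subseteq> {..<s}" by (auto simp: I_def)
  define f where "f = e_sum R u I"
  have f: "f \<in> carrier R" "f \<otimes> f = f"
    using e_sum_mult[OF I I] e_sum_closed[OF I] by (simp_all add: f_def)
  have diff: "e \<ominus> f \<in> jacobson_rad R"
  proof (rule component_kernel)
    show "e \<ominus> f \<in> carrier R" using e' f by simp
    fix i assume i: "i < s"
    interpret h: ring_hom_ring R "Bs ! i" "component i" using i by (rule component_ring_hom_ring)
    have "component i f = (if i \<in> I then \<one>\<^bsub>Bs ! i\<^esub> else \<zero>\<^bsub>Bs ! i\<^esub>)"
      unfolding f_def by (rule component_e_sum[OF i I])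
    then have "component i e = component i f"
      using I_l_component[OF nz e i] i by (auto simp only: I_def mem_Collect_eq if_True if_False split: if_splits)
    then show "component i (e \<ominus> f) = \<zero>\<^bsub>Bs ! i\<^esub>"
      using e' f by (simp add: a_minus_def h.S.r_neg)
  qed
  define x where "x = \<one> \<ominus> f"
  define y where "y = \<one> \<ominus> e"
  have x: "x \<in> carrier R" "x \<otimes> x = x"
    using f by (simp_all add: x_def a_minus_def l_distr r_distr l_minus r_minus r_neg)
  have y: "y \<in> carrier R" using e' by (simp add: y_def)
  have "e \<otimes> x = \<zero>"
  proof (rule jacobson_rad_idempotent_zero)
    have "e \<otimes> x = e \<otimes> (e \<ominus> f)"
      using e' f by (simp add: x_def a_minus_def r_distr)
    then show "e \<otimes> x \<in> jacobson_rad R" using diff e' by (simp add: J.I_l_closed)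
    have "e \<otimes> x \<otimes> (e \<otimes> x) = (e \<otimes> x \<otimes> e) \<otimes> x" using e'(1) x(1) by (simp add: m_assoc)
    also have "\<dots> = e \<otimes> x \<otimes> x" using corner x(1) by simp
    also have "\<dots> = e \<otimes> x" using e'(1) x by (simp add: m_assoc)
    finally show "e \<otimes> x \<otimes> (e \<otimes> x) = e \<otimes> x" .
  qed
  then have ef: "e \<otimes> f = e" using e' f by (simp add: x_def mult_compl_eq_zero_iff)
  have "f \<otimes> y = \<zero>"
  proof (rule jacobson_rad_idempotent_zero)
    have "f \<otimes> y = (\<ominus> f) \<otimes> (e \<ominus> f)"
      using e' f by (simp add: y_def a_minus_def r_distr l_minus r_minus a_comm)
    then show "f \<otimes> y \<in> jacobson_rad R" using diff f by (simp add: J.I_l_closed)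
    have "e \<otimes> (f \<otimes> y) = \<zero>"
      using corner e'(1) f(1) by (simp add: y_def mult_compl_eq_zero_iff flip: m_assoc)
    then have yfy: "y \<otimes> (f \<otimes> y) = f \<otimes> y"
      using e'(1) f(1) y by (simp add: y_def[THEN arg_cong[of _ _ "\<lambda>a. a \<otimes> (f \<otimes> y)"]]
          a_minus_def[of R \<one> e] l_distr l_minus)
    have "f \<otimes> y \<otimes> (f \<otimes> y) = f \<otimes> (y \<otimes> (f \<otimes> y))" using f(1) y by (simp add: m_assoc)
    also have "\<dots> = f \<otimes> y" using f y by (simp add: yfy flip: m_assoc)
    finally show "f \<otimes> y \<otimes> (f \<otimes> y) = f \<otimes> y" .
  qed
  then have fe: "f \<otimes> e = f" using e' f by (simp add: y_def mult_compl_eq_zero_iff)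
  have "I \<noteq> {}" using ef e' by (auto simp: f_def e_sum_empty)
  moreover have "f \<otimes> r \<otimes> f = f \<otimes> r" if r: "r \<in> carrier R" for r
  proof -
    \<comment> \<open>The corner condition passes from \<open>e\<close> to \<open>f\<close>, because \<open>f = fe\<close> and \<open>ef = e\<close>.\<close>
    have "f \<otimes> r \<otimes> f = f \<otimes> (e \<otimes> r \<otimes> e) \<otimes> f"
      using r e' f fe corner by (simp flip: m_assoc)
    also have "\<dots> = f \<otimes> (e \<otimes> r \<otimes> (e \<otimes> f))" using r e'(1) f(1) by (simp add: m_assoc)
    also have "\<dots> = f \<otimes> e \<otimes> r" using r e'(1) f(1) corner by (simp add: ef m_assoc[of f e r])
    finally show ?thesis by (simp add: fe)
  qed
  ultimately have "f \<in> I_l' R s u" using I unfolding I_l'_iff f_def by blast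
  moreover have "compl_ideal R e = compl_ideal R f"
    using compl_ideal_subset_iff[OF e'(1,2) f] compl_ideal_subset_iff[OF f e'(1,2)] ef fe
    by (auto simp: idem_ge_def)
  ultimately show thesis by (rule that)
qed

end

section \<open>Localizations of a left Artinian ring\<close>

theorem theorem4p6:
  fixes R :: "('a, 'm) ring_scheme"
    and Bs :: "('b, 'n) ring_scheme list"
    and \<phi> :: "'a set \<Rightarrow> 'b list"
    and u :: "nat \<Rightarrow> 'a"
    and s :: nat
  assumes "ring R" and "\<one>\<^bsub>R\<^esub> \<noteq> \<zero>\<^bsub>R\<^esub>" and "left_artinian R"
    and "length Bs = s" and "\<forall>i<s. simple_artinian (Bs ! i)"
    and "\<phi> \<in> ring_iso (R Quot jacobson_rad R) (RDirProd_list Bs)"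
    and "\<forall>i<s. u i \<in> carrier R \<and> u i \<otimes>\<^bsub>R\<^esub> u i = u i"
    and "\<forall>i<s. \<forall>j<s. i \<noteq> j \<longrightarrow> u i \<otimes>\<^bsub>R\<^esub> u j = \<zero>\<^bsub>R\<^esub>"
    and "(\<Oplus>\<^bsub>R\<^esub>i\<in>{..<s}. u i) = \<one>\<^bsub>R\<^esub>"
    and "\<forall>i<s. \<phi> (jacobson_rad R +>\<^bsub>R\<^esub> u i) = factor_one Bs i"
  shows
    \<comment> \<open>1\<close>
    "((\<forall>e\<in>I_l' R s u. ass R (S_idem R e) = compl_ideal R e) \<and>
      bij_betw (\<lambda>e. ass R (S_idem R e)) (I_l' R s u)
        {ass R (S_idem R e) | e. e \<in> I_l' R s u}) \<and>
     \<comment> \<open>2\<close>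
     bij_betw (\<lambda>e. idem_class R e) (I_l' R s u) (I_l R // idem_sim R) \<and>
     \<comment> \<open>3\<close>
     ((\<forall>e\<in>I_l' R s u. ideal (compl_ideal R e) R \<and>
        (\<exists>h \<in> ring_iso (localization R (S_idem R e)) (R Quot compl_ideal R e).
           \<forall>r\<in>carrier R. h (loc_can R (S_idem R e) r) = compl_ideal R e +>\<^bsub>R\<^esub> r)) \<and>
      bij_betw (\<lambda>e. loc_class R (S_idem R e)) (I_l' R s u) (Loc_l R) \<and>
      Loc_l R = {loc_class R (S_idem R e) | e. e \<in> I_l' R s u} \<and>
      card (Loc_l R) = card (I_l' R s u) \<and> finite (I_l' R s u) \<and> finite (Loc_l R)) \<and>
     \<comment> \<open>4\<close>
     (\<forall>e\<in>I_l' R s u. \<forall>f\<in>I_l' R s u.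
        (R_isomorphic R (S_idem R e) (S_idem R f) \<longleftrightarrow>
           ass R (S_idem R e) = ass R (S_idem R f)) \<and>
        (ass R (S_idem R e) = ass R (S_idem R f) \<longleftrightarrow> e = f)) \<and>
     \<comment> \<open>5\<close>
     (\<forall>e\<in>I_l' R s u. \<forall>f\<in>I_l' R s u.
        (idem_ge R e f \<longleftrightarrow> class_ge R (idem_class R e) (idem_class R f)) \<and>
        (class_ge R (idem_class R e) (idem_class R f) \<longleftrightarrow>
           (\<exists>h. fraction_map R (S_idem R e) (S_idem R f) h)) \<and>
        (\<forall>h. fraction_map R (S_idem R e) (S_idem R f) h \<longrightarrow>
           (\<forall>t\<in>S_idem R e. \<forall>r\<in>carrier R.
              h (lfrac R (S_idem R e) t r) = loc_can R (S_idem R f) r)) \<and>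
        ((\<exists>h. fraction_map R (S_idem R e) (S_idem R f) h) \<longleftrightarrow>
           ass R (S_idem R e) \<subseteq> ass R (S_idem R f))) \<and>
     \<comment> \<open>6\<close>
     (bij_betw (\<lambda>e. compl_ideal R e) (I_l' R s u) (Ass_l R) \<and>
      Ass_l R = {compl_ideal R e | e. e \<in> I_l' R s u} \<and>
      finite (Ass_l R) \<and> card (Ass_l R) = card (I_l' R s u))"
proof -
  note nz = assms(2) and art = assms(3)
  interpret ring R by (rule assms(1))
  interpret lifted_central_idempotents R Bs \<phi> u s
    using assms by unfold_locales auto
  let ?A = "I_l' R s u"
  have A_I_l: "e \<in> I_l R" if "e \<in> ?A" for e
    using that I_l'_subset_I_l[OF nz] by blast
  have Den: "S_idem R e \<in> Den_l R" if "e \<in> I_l R" for e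
    using that by (simp add: I_l_def)
  have ass_e: "ass R (S_idem R e) = compl_ideal R e" if "e \<in> I_l R" for e
    using that by (intro ass_idempotent) (simp_all add: I_l_def)
  have compl_eq: "compl_ideal R e = compl_ideal R f \<longleftrightarrow> e = f" if "e \<in> ?A" "f \<in> ?A" for e f
    using compl_ideal_inj_on_I_l'[OF nz that] by blast
  have rep: "\<exists>e\<in>?A. ass R S = compl_ideal R e" if S: "S \<in> Den_l R" for S
  proof -
    obtain e where "e \<in> I_l R" "ass R S = compl_ideal R e"
      using denominator_set.artinian_ass_eq_compl_ideal[OF Den_l_denominator_set[OF S] art] .
    then show ?thesis using I_l_equivalent_I_l'[OF nz] by metis
  qed
  have loc: "inverting_quotient R (S_idem R e) (localization R (S_idem R e)) (loc_can R (S_idem R e))"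
    if "e \<in> ?A" for e
    using artinian_localization[OF art Den[OF A_I_l[OF that]]] .

  have p1: "bij_betw (\<lambda>e. ass R (S_idem R e)) ?A {ass R (S_idem R e) | e. e \<in> ?A}"
    by (intro bij_betw_imageI inj_onI) (simp_all add: ass_e[OF A_I_l] compl_eq setcompr_eq_image)

  have p2: "bij_betw (\<lambda>e. idem_class R e) ?A (I_l R // idem_sim R)"
  proof (intro bij_betw_imageI inj_onI)
    show "e = f" if "e \<in> ?A" "f \<in> ?A" "idem_class R e = idem_class R f" for e f
      using that by (simp add: idem_class_eq_iff[OF nz A_I_l A_I_l] compl_eq)
    have "idem_class R e \<in> idem_class R ` ?A" if e: "e \<in> I_l R" for e
      using I_l_equivalent_I_l'[OF nz e] idem_class_eq_iff[OF nz e A_I_l] by (metis imageI)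
    moreover have "I_l R // idem_sim R = idem_class R ` I_l R"
      by (auto simp: quotient_def idem_class_def)
    ultimately show "idem_class R ` ?A = I_l R // idem_sim R"
      using A_I_l by auto
  qed

  have p3: "ideal (compl_ideal R e) R \<and>
        (\<exists>h \<in> ring_iso (localization R (S_idem R e)) (R Quot compl_ideal R e).
           \<forall>r\<in>carrier R. h (loc_can R (S_idem R e) r) = compl_ideal R e +>\<^bsub>R\<^esub> r)"
    if e: "e \<in> ?A" for e
  proof -
    interpret D: denominator_set R "S_idem R e"
      using Den[OF A_I_l[OF e]] by (rule Den_l_denominator_set)
    show ?thesis
      using D.ass_ideal inverting_quotient.quotient_iso[OF D.artinian_inverting_quotient[OF art]]
      by (simp only: ass_e[OF A_I_l[OF e]])
  qed

  have loc_rep: "\<exists>e\<in>?A. loc_class R S = loc_class R (S_idem R e)" if S: "S \<in> Den_l R" for S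
  proof -
    obtain e where e: "e \<in> ?A" "ass R S = compl_ideal R e" using rep[OF S] by blast
    then show ?thesis
      using loc_class_eq_iff[OF art S Den[OF A_I_l[OF e(1)]]] ass_e[OF A_I_l[OF e(1)]] by auto
  qed
  have Loc: "Loc_l R = {loc_class R (S_idem R e) | e. e \<in> ?A}"
    unfolding Loc_l_def using loc_rep Den[OF A_I_l] by blast
  have loc_bij: "bij_betw (\<lambda>e. loc_class R (S_idem R e)) ?A (Loc_l R)"
  proof (intro bij_betw_imageI inj_onI)
    show "e = f"
      if "e \<in> ?A" "f \<in> ?A" "loc_class R (S_idem R e) = loc_class R (S_idem R f)" for e f
      using that loc_class_eq_iff[OF art Den[OF A_I_l] Den[OF A_I_l], of e f]
      by (simp add: ass_e[OF A_I_l] compl_eq)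
    show "(\<lambda>e. loc_class R (S_idem R e)) ` ?A = Loc_l R" unfolding Loc by blast
  qed

  have p4: "(R_isomorphic R (S_idem R e) (S_idem R f) \<longleftrightarrow>
           ass R (S_idem R e) = ass R (S_idem R f)) \<and>
        (ass R (S_idem R e) = ass R (S_idem R f) \<longleftrightarrow> e = f)"
    if "e \<in> ?A" "f \<in> ?A" for e f
    using that R_isomorphic_iff[OF loc loc, of e f] by (simp add: ass_e[OF A_I_l] compl_eq)

  have p5: "(idem_ge R e f \<longleftrightarrow> class_ge R (idem_class R e) (idem_class R f)) \<and>
        (class_ge R (idem_class R e) (idem_class R f) \<longleftrightarrow>
           (\<exists>h. fraction_map R (S_idem R e) (S_idem R f) h)) \<and>
        (\<forall>h. fraction_map R (S_idem R e) (S_idem R f) h \<longrightarrow>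
           (\<forall>t\<in>S_idem R e. \<forall>r\<in>carrier R.
              h (lfrac R (S_idem R e) t r) = loc_can R (S_idem R f) r)) \<and>
        ((\<exists>h. fraction_map R (S_idem R e) (S_idem R f) h) \<longleftrightarrow>
           ass R (S_idem R e) \<subseteq> ass R (S_idem R f))"
    if e: "e \<in> ?A" and f: "f \<in> ?A" for e f
  proof -
    have "h (lfrac R (S_idem R e) t r) = loc_can R (S_idem R f) r"
      if h: "fraction_map R (S_idem R e) (S_idem R f) h"
        and t: "t \<in> S_idem R e" and r: "r \<in> carrier R" for h t r
    proof -
      have "t \<otimes>\<^bsub>R\<^esub> t = t" using t A_I_l[OF e] by (auto simp: S_idem_def I_l_def)
      then have "lfrac R (S_idem R e) t r = loc_can R (S_idem R e) r"
        using inverting_quotient.lfrac_idempotent_denominator[OF loc[OF e] t _ r] by simp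
      then show ?thesis using fraction_map_loc_can[OF loc[OF e] loc[OF f] h r] by simp
    qed
    then show ?thesis
      using e f idem_ge_iff_compl_ideal[OF nz A_I_l A_I_l, of e f]
        class_ge_iff_compl_ideal[OF nz A_I_l A_I_l, of e f] fraction_map_iff[OF loc loc, of e f]
      by (simp add: ass_e[OF A_I_l])
  qed

  have Ass: "Ass_l R = {compl_ideal R e | e. e \<in> ?A}"
  proof (intro equalityI subsetI)
    fix I assume "I \<in> {compl_ideal R e | e. e \<in> ?A}"
    then obtain e where "e \<in> ?A" "I = ass R (S_idem R e)" using ass_e[OF A_I_l] by blast
    then show "I \<in> Ass_l R" using Den[OF A_I_l] unfolding Ass_l_def by blast
  qed (use rep in \<open>auto simp: Ass_l_def\<close>)
  have ass_bij: "bij_betw (\<lambda>e. compl_ideal R e) ?A (Ass_l R)"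
    unfolding Ass by (intro bij_betw_imageI inj_onI) (auto simp: compl_eq)

  show ?thesis
    using ass_e[OF A_I_l] p1 p2 p3 loc_bij Loc p4 p5 ass_bij Ass finite_I_l'
      bij_betw_same_card[OF loc_bij] bij_betw_same_card[OF ass_bij]
      bij_betw_finite[OF loc_bij] bij_betw_finite[OF ass_bij]
    by (intro conjI ballI) simp_all
qed

end
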